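(* Assume that $g_\theta$ and $g_\kappa$ both have radius of convergence $R>0$, with $g_\theta(R)<\infty$, $g_\kappa(R)<\infty$, $g_\kappa^{\{1\}}(R)=1$ and $0<g_\kappa^{\{2\}}(R)<\infty$. Let $f$ be holomorphic in the open disk $|z|<R$ and continuous up to the boundary $|z|=R$. Then, uniformly in $v\in[1,v_0]$ for an arbitrary constant $v_0\ge1$, $$[z^N]\big[f(z)\exp\{vG_N(z)\}\big]\sim\frac{f(r_v)\exp\{vG_N(r_v)\}}{r_v^N\sqrt{2\pi Nv\,b_2(r_v)}},\qquad N\to\infty.$$ In particular, $H_N\sim\dfrac{\exp\{G_N(R)\}}{R^N\sqrt{2\pi Nb_2(R)}}$ as $N\to\infty$.
   Context: $(\theta_j)_{j\ge1}$, $(\kappa_j)_{j\ge1}$ are sequences of nonnegative reals; $g_\theta(z)=\sum_{j\ge1}\theta_jz^j/j$, $g_\kappa(z)=\sum_{j\ge1}\kappa_jz^j/j$, $G_N=g_\theta+Ng_\kappa$, with values at $R$ defined as limits $r\uparrow R$. $[z^N]F(z)$ is the coefficient of $z^N$. $H_N=\frac1{N!}\sum_{\sigma\in S_N}\prod_{j=1}^N(\theta_j+N\kappa_j)^{C_j(\sigma)}$, $C_j(\sigma)$ the number of $j$-cycles of $\sigma$. $g^{\{n\}}(z)=z^ng^{(n)}(z)$, $g_\kappa^{\{n\}}(R):=\lim_{r\uparrow R}g_\kappa^{\{n\}}(r)$. $b_2(r)=g_\kappa^{\{1\}}(r)+g_\kappa^{\{2\}}(r)$. For $v\ge1$, $r_v\in(0,R]$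 is the unique solution of $g_\kappa^{\{1\}}(r)=1/v$ (so $r_1=R$). Standing assumption: $(\kappa_j)$ is non-arithmetic (no integer $j_0>1$ such that $\kappa_j\ne0$ implies $j_0\mid j$) and $\kappa_j>0$ for some $j\ge2$.
   Formalization: Since f(r_v) may vanish, where the ratio is undefined, "∼" is proved with f(r_v) replaced by f(r_v)+o(1), uniformly in v∈[1,v_0]; if f(r_v)≠0 on [1,v_0] this is the uniform asymptotic equivalence as stated. *)

theory Defs
  imports "HOL-Analysis.Analysis" "HOL-Combinatorics.Orbits" "HOL-Library.Landau_Symbols"
begin

text \<open>g_c(z) = sum_{j>=1} c_j z^j / j  (the j = 0 term vanishes since c_0/0 = 0 in HOL).\<close>
definition gC :: "(nat \<Rightarrow> real) \<Rightarrow> complex \<Rightarrow> complex" where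
  "gC c z = (\<Sum>j. complex_of_real (c j / real j) * z ^ j)"

definition gR :: "(nat \<Rightarrow> real) \<Rightarrow> real \<Rightarrow> real" where
  "gR c r = (\<Sum>j. c j / real j * r ^ j)"

definition gdiff :: "nat \<Rightarrow> (nat \<Rightarrow> real) \<Rightarrow> real \<Rightarrow> real" where
  "gdiff n c r = r ^ n * (deriv ^^ n) (gR c) r"

definition at_bd :: "real \<Rightarrow> (real \<Rightarrow> real) \<Rightarrow> real \<Rightarrow> real" where
  "at_bd R F r = (if r < R then F r else Lim (at_left R) F)"

definition zcoeff :: "(complex \<Rightarrow> complex) \<Rightarrow> nat \<Rightarrow> complex" where
  "zcoeff F N = (deriv ^^ N) F 0 / of_nat (fact N)"

definition GNR :: "real \<Rightarrow> (nat \<Rightarrow> real) \<Rightarrow> (nat \<Rightarrow> real) \<Rightarrow> nat \<Rightarrow> real \<Rightarrow> real" where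
  "GNR R \<theta> \<kappa> N r = at_bd R (gR \<theta>) r + real N * at_bd R (gR \<kappa>) r"

definition rsol :: "real \<Rightarrow> (nat \<Rightarrow> real) \<Rightarrow> real \<Rightarrow> real" where
  "rsol R \<kappa> v = (THE r. 0 < r \<and> r \<le> R \<and> at_bd R (gdiff 1 \<kappa>) r = 1 / v)"

definition b2 :: "real \<Rightarrow> (nat \<Rightarrow> real) \<Rightarrow> real \<Rightarrow> real" where
  "b2 R \<kappa> r = at_bd R (gdiff 1 \<kappa>) r + at_bd R (gdiff 2 \<kappa>) r"

definition cycle_count :: "nat \<Rightarrow> (nat \<Rightarrow> nat) \<Rightarrow> nat \<Rightarrow> nat" where
  "cycle_count N \<sigma> j = card {orbit \<sigma> x | x. x \<in> {1..N} \<and> card (orbit \<sigma> x) = j}"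

definition HN :: "(nat \<Rightarrow> real) \<Rightarrow> (nat \<Rightarrow> real) \<Rightarrow> nat \<Rightarrow> real" where
  "HN \<theta> \<kappa> N = (1 / fact N) * (\<Sum>\<sigma> \<in> {\<sigma>. \<sigma> permutes {1..N}}.
      \<Prod>j = 1..N. (\<theta> j + real N * \<kappa> j) ^ cycle_count N \<sigma> j)"

end

theory Submission
  imports Defs "HOL-Complex_Analysis.Complex_Analysis" "HOL-Probability.Probability"
begin

text \<open>Cauchy's formula on the circle of radius \<open>r = r_v\<close> (allowed to be \<open>R\<close> itself, since the integrand
  is continuous up to the boundary) has the phase \<open>N v \<Sum> a_j r^j (e^{ijt} - 1 - ijt)\<close> with
  \<open>a_j = \<kappa>_j / j\<close>; the linear term is exactly the factor \<open>e^{-iNt}\<close> because \<open>v g_\<kappa>^{{1}}(r) = 1\<close>.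
  Only \<open>\<Sum> j^2 a_j R^j < \<infinity>\<close> is available, and it suffices: after the scaling \<open>t = s / sqrt N\<close> it
  dominates the series in the expansion of the phase, so the phase tends to
  \<open>- v b_2(r) s^2 / 2\<close>. The integrand is dominated by \<open>exp (- c s^2)\<close> because non-arithmeticity gives
  \<open>\<Sum> a_j r^j (1 - cos jt) \<ge> c t^2\<close> on the whole circle. Dominated convergence applies equally when
  \<open>v\<close> varies with \<open>N\<close>, which is uniformity.

  \<open>H_N\<close> is the \<open>N\<close>-th coefficient of \<open>exp G_N\<close> by the exponential formula: both sides satisfy
  \<open>n h_n = \<Sum>_{k=1}^n x_k h_{n-k}\<close>.\<close>

section \<open>Cycle weights of permutations\<close>

lemma orbit_transpose_insert:
  assumes p: "p permutes S" "finite S" and a: "a \<notin> S" and b: "b \<in> S"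
  defines "q \<equiv> Transposition.transpose a b \<circ> p"
  shows "orbit q a = insert a (orbit p b)"
    and "x \<notin> orbit p b \<Longrightarrow> x \<in> S \<Longrightarrow> orbit q x = orbit p x"
    and "q permutes insert a S"
proof -
  show qp: "q permutes insert a S"
    unfolding q_def using p a b
    by (meson insertCI permutes_compose permutes_subset permutes_swap_id subset_insertI)
  have permp: "permutation p" and permq: "permutation q"
    using p qp permutation_permutes by blast+
  have pa: "p a = a" using p a by (simp add: permutes_not_in)
  have pna: "p y \<noteq> a" if "y \<noteq> a" for y
    using that pa p(1) by (metis permutes_def)
  have qa: "q a = b" by (simp add: q_def pa)
  have q1: "q y = a" if "p y = b" for y using that by (simp add: q_def)
  have q2: "q y = p y" if "y \<noteq> a" "p y \<noteq> b" for y
    using pna[OF that(1)] that by (simp add: q_def Transposition.transpose_def)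
  have sub: "orbit p b \<subseteq> S" using permutes_orbit_subset[OF p(1) b] .
  show "orbit q a = insert a (orbit p b)"
  proof (intro equalityI subsetI)
    fix y assume "y \<in> orbit q a"
    then show "y \<in> insert a (orbit p b)"
    proof induction
      case base
      show ?case using qa permutation_self_in_orbit[OF permp, of b] by simp
    next
      case (step y)
      then show ?case
      proof (cases "y = a")
        case True
        then show ?thesis using qa permutation_self_in_orbit[OF permp, of b] by simp
      next
        case False
        then have "p y \<in> orbit p b" using step by (auto intro: orbit.intros)
        then show ?thesis using q1[of y] q2[OF False] by (cases "p y = b") auto
      qed
    qed
  next
    fix y assume "y \<in> insert a (orbit p b)"
    moreover have ba: "b \<in> orbit q a" using orbit.base[of q a] qa by simp
    moreover have "y \<in> orbit q a" if "y \<in> orbit p b" using that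
    proof induction
      case base
      show ?case
        using q2[of b] ba orbit.step[OF ba] a b by (cases "p b = b"; cases "b = a") auto
    next
      case (step y)
      then have "y \<noteq> a" using sub a by auto
      then show ?case using q2[of y] ba orbit.step[OF step(2)] by (cases "p y = b") auto
    qed
    ultimately show "y \<in> orbit q a"
      using permutation_self_in_orbit[OF permq] by blast
  qed
  assume x: "x \<notin> orbit p b" "x \<in> S"
  have nb: "y \<noteq> b" if "y \<in> orbit p x" for y
    using x(1) that orbit_swap[OF permutation_self_in_orbit[OF permp], of b x]
    by (auto simp: permutation_self_in_orbit[OF permp])
  show "orbit q x = orbit p x"
  proof (rule orbit_cong0[of x "orbit p x"])
    show "x \<in> orbit p x" using permutation_self_in_orbit[OF permp] .
    show "q \<in> orbit p x \<rightarrow> orbit p x"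
    proof
      fix y assume y: "y \<in> orbit p x"
      then have "p y \<in> orbit p x" by (rule orbit.step)
      moreover have "y \<noteq> a" using y permutes_orbit_subset[OF p(1) x(2)] a by auto
      ultimately show "q y \<in> orbit p x" using nb q2 by metis
    qed
    fix y assume y: "y \<in> orbit p x"
    have "p y \<in> orbit p x" using y by (rule orbit.step)
    moreover have "y \<noteq> a" using y permutes_orbit_subset[OF p(1) x(2)] a by auto
    ultimately show "q y = p y" using nb q2 by metis
  qed
qed

definition cycle_sum :: "(nat \<Rightarrow> real) \<Rightarrow> 'a set \<Rightarrow> real" where
  "cycle_sum x S = (\<Sum>\<sigma> | \<sigma> permutes S. \<Prod>C \<in> orbit \<sigma> ` S. x (card C))"

text \<open>The cycle through the marked point \<open>a\<close> is weighted as if it were longer by \<open>k\<close>; deleting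
  \<open>a\<close> from its cycle then yields a recursion.\<close>
definition marked_cycle_sum :: "(nat \<Rightarrow> real) \<Rightarrow> 'a set \<Rightarrow> 'a \<Rightarrow> nat \<Rightarrow> real" where
  "marked_cycle_sum x S a k = (\<Sum>\<sigma> | \<sigma> permutes S.
     x (card (orbit \<sigma> a) + k) * (\<Prod>C \<in> orbit \<sigma> ` S - {orbit \<sigma> a}. x (card C)))"

lemma cycle_sum_eq_marked:
  assumes "finite S" "a \<in> S"
  shows "cycle_sum x S = marked_cycle_sum x S a 0"
proof -
  have "(\<Prod>C \<in> orbit \<sigma> ` S. x (card C))
      = x (card (orbit \<sigma> a)) * (\<Prod>C \<in> orbit \<sigma> ` S - {orbit \<sigma> a}. x (card C))" for \<sigma>
    by (rule prod.remove) (use assms in auto)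
  then show ?thesis unfolding cycle_sum_def marked_cycle_sum_def by simp
qed

lemma marked_cycle_sum_insert:
  assumes S: "finite S" and a: "a \<notin> S"
  shows "marked_cycle_sum x (insert a S) a k
       = x (Suc k) * cycle_sum x S + (\<Sum>b\<in>S. marked_cycle_sum x S b (Suc k))"
proof -
  let ?w = "\<lambda>S a k \<sigma>. x (card (orbit \<sigma> a) + k) * (\<Prod>C \<in> orbit \<sigma> ` S - {orbit \<sigma> a}. x (card C))"
  have fixed: "?w (insert a S) a k (Transposition.transpose a a \<circ> p) = x (Suc k) * (\<Prod>C \<in> orbit p ` S. x (card C))"
    if p: "p permutes S" for p
  proof -
    have oa: "orbit p a = {a}" using p a by (simp add: orbit_eq_singleton_iff permutes_not_in)
    have "orbit p ` insert a S - {orbit p a} = orbit p ` S"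
      using permutes_orbit_subset[OF p] a oa by auto
    then show ?thesis by (simp add: oa)
  qed
  have moved: "?w (insert a S) a k (Transposition.transpose a b \<circ> p) = ?w S b (Suc k) p"
    if p: "p permutes S" and b: "b \<in> S" for p b
  proof -
    let ?q = "Transposition.transpose a b \<circ> p"
    note q = orbit_transpose_insert[OF p S a b]
    have permp: "permutation p" and permq: "permutation ?q"
      using p q(3) S permutation_permutes by blast+
    have sub: "orbit p y \<subseteq> S" if "y \<in> S" for y using permutes_orbit_subset[OF p that] .
    have fin: "finite (orbit p b)" using sub[OF b] S finite_subset by blast
    have same: "orbit ?q y = orbit ?q a" if "y \<in> orbit p b" for y
    proof -
      have "y \<in> orbit ?q a" using q(1) that by simp
      then show ?thesis
        using orbit_cyclic_eq3[OF cyclic_on_orbit'[OF permq]] by blast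
    qed
    have same': "orbit p y = orbit p b" if "y \<in> orbit p b" for y
      using that orbit_cyclic_eq3[OF cyclic_on_orbit'[OF permp]] by blast
    have "orbit ?q ` insert a S - {orbit ?q a} = orbit p ` S - {orbit p b}"
    proof (intro equalityI subsetI)
      fix C assume "C \<in> orbit ?q ` insert a S - {orbit ?q a}"
      then obtain y where y: "y \<in> S" "C = orbit ?q y" "C \<noteq> orbit ?q a" by auto
      then have "y \<notin> orbit p b" using same by auto
      then have "C = orbit p y" "orbit p y \<noteq> orbit p b"
        using q(2) y permutation_self_in_orbit[OF permp, of y] by auto
      then show "C \<in> orbit p ` S - {orbit p b}" using y by auto
    next
      fix C assume "C \<in> orbit p ` S - {orbit p b}"
      then obtain y where y: "y \<in> S" "C = orbit p y" "C \<noteq> orbit p b" by auto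
      then have "y \<notin> orbit p b" using same' by auto
      then have "C = orbit ?q y" using q(2) y by auto
      moreover have "C \<noteq> orbit ?q a" using q(1) sub[OF y(1)] y(2) a by auto
      ultimately show "C \<in> orbit ?q ` insert a S - {orbit ?q a}" using y by auto
    qed
    moreover have "card (orbit ?q a) = Suc (card (orbit p b))"
      using q(1) sub[OF b] a fin by (metis card_insert_disjoint subsetD)
    ultimately show ?thesis by simp
  qed
  have "marked_cycle_sum x (insert a S) a k
      = (\<Sum>b\<in>insert a S. \<Sum>p | p permutes S. ?w (insert a S) a k (Transposition.transpose a b \<circ> p))"
    unfolding marked_cycle_sum_def by (rule sum_over_permutations_insert[OF S a])
  also have "\<dots> = (\<Sum>p | p permutes S. ?w (insert a S) a k (Transposition.transpose a a \<circ> p))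
      + (\<Sum>b\<in>S. \<Sum>p | p permutes S. ?w (insert a S) a k (Transposition.transpose a b \<circ> p))"
    using S a by (rule sum.insert)
  also have "(\<Sum>p | p permutes S. ?w (insert a S) a k (Transposition.transpose a a \<circ> p)) = x (Suc k) * cycle_sum x S"
    unfolding cycle_sum_def sum_distrib_left using fixed by (intro sum.cong refl) blast
  also have "(\<Sum>b\<in>S. \<Sum>p | p permutes S. ?w (insert a S) a k (Transposition.transpose a b \<circ> p))
      = (\<Sum>b\<in>S. marked_cycle_sum x S b (Suc k))"
    unfolding marked_cycle_sum_def using moved by (intro sum.cong refl) blast
  finally show ?thesis .
qed

lemma cycle_sum_recursion:
  assumes c0: "c 0 = 1"
    and c: "\<And>n. real (Suc n) * c (Suc n) = (\<Sum>i\<le>n. x (Suc i) * c (n - i))"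
    and S: "finite S" "card S = n"
  shows "cycle_sum x S = fact n * c n"
proof -
  have "cycle_sum x S = fact n * c n \<and> (\<forall>a\<in>S. \<forall>k.
      marked_cycle_sum x S a k = fact (n - 1) * (\<Sum>i<n. x (Suc i + k) * c (n - 1 - i)))"
    using S
  proof (induction n arbitrary: S)
    case 0
    then show ?case by (simp add: cycle_sum_def c0)
  next
    case (Suc n)
    have m: "marked_cycle_sum x S a k = fact n * (\<Sum>i<Suc n. x (Suc i + k) * c (n - i))"
      if a: "a \<in> S" for a k
    proof -
      define T where "T = S - {a}"
      have T: "finite T" "card T = n" "a \<notin> T" "S = insert a T"
        using Suc.prems a by (auto simp: T_def)
      have "(\<Sum>b\<in>T. marked_cycle_sum x T b (Suc k))
          = real n * (fact (n - 1) * (\<Sum>i<n. x (Suc i + Suc k) * c (n - 1 - i)))"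
        using Suc.IH[OF T(1,2)] T(2) by simp
      also have "\<dots> = fact n * (\<Sum>i<n. x (Suc (Suc i) + k) * c (n - Suc i))"
        by (cases n) (simp_all add: algebra_simps)
      finally have "(\<Sum>b\<in>T. marked_cycle_sum x T b (Suc k))
        = fact n * (\<Sum>i<n. x (Suc (Suc i) + k) * c (n - Suc i))" .
      then have "marked_cycle_sum x S a k = x (Suc k) * (fact n * c n)
          + fact n * (\<Sum>i<n. x (Suc (Suc i) + k) * c (n - Suc i))"
        unfolding T(4) marked_cycle_sum_insert[OF T(1,3)] using Suc.IH[OF T(1,2)] by simp
      then show ?thesis
        by (simp only: sum.lessThan_Suc_shift) (simp add: algebra_simps)
    qed
    obtain a where a: "a \<in> S" using Suc.prems by fastforce
    have "cycle_sum x S = fact n * (\<Sum>i<Suc n. x (Suc i) * c (n - i))"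
      using cycle_sum_eq_marked[OF Suc.prems(1) a, of x] m[OF a, of 0] by simp
    also have "\<dots> = fact (Suc n) * c (Suc n)"
      using c[of n] by (simp add: lessThan_Suc_atMost mult.commute mult.left_commute flip: mult.assoc)
    finally show ?case using m by simp
  qed
  then show ?thesis by blast
qed

lemma HN_eq_cycle_sum:
  "HN \<theta> \<kappa> N = cycle_sum (\<lambda>j. \<theta> j + real N * \<kappa> j) {1..N} / fact N"
proof -
  let ?x = "\<lambda>j. \<theta> j + real N * \<kappa> j"
  have "(\<Prod>j = 1..N. ?x j ^ cycle_count N \<sigma> j) = (\<Prod>C \<in> orbit \<sigma> ` {1..N}. ?x (card C))"
    if s: "\<sigma> permutes {1..N}" for \<sigma>
  proof -
    have sub: "orbit \<sigma> y \<subseteq> {1..N}" if "y \<in> {1..N}" for y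
      using permutes_orbit_subset[OF s that] .
    have cc: "cycle_count N \<sigma> j = card {C \<in> orbit \<sigma> ` {1..N}. card C = j}" for j
      unfolding cycle_count_def by (rule arg_cong[of _ _ card]) auto
    have img: "card ` (orbit \<sigma> ` {1..N}) \<subseteq> {1..N}"
    proof clarify
      fix y assume y: "y \<in> {1..N}"
      have "card (orbit \<sigma> y) \<le> N" using card_mono[OF _ sub[OF y]] by simp
      moreover have "card (orbit \<sigma> y) \<noteq> 0"
        using sub[OF y] orbit_nonempty[of \<sigma> y] finite_subset by fastforce
      ultimately show "card (orbit \<sigma> y) \<in> {1..N}" by simp
    qed
    have "(\<Prod>C \<in> orbit \<sigma> ` {1..N}. ?x (card C))
        = (\<Prod>j = 1..N. \<Prod>C \<in> {C \<in> orbit \<sigma> ` {1..N}. card C = j}. ?x (card C))"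
      using prod.group[of "orbit \<sigma> ` {1..N}" "{1..N}" card "\<lambda>C. ?x (card C)"] img by simp
    also have "\<dots> = (\<Prod>j = 1..N. \<Prod>C \<in> {C \<in> orbit \<sigma> ` {1..N}. card C = j}. ?x j)"
      by (intro prod.cong refl) simp
    finally show ?thesis by (simp add: cc)
  qed
  then show ?thesis unfolding HN_def cycle_sum_def by simp
qed

section \<open>Power series and coefficients\<close>

lemma summable_power_series_boundary:
  fixes a :: "nat \<Rightarrow> real"
  assumes a: "\<And>n. 0 \<le> a n" and R: "0 < R"
    and summ: "\<And>r. 0 \<le> r \<Longrightarrow> r < R \<Longrightarrow> summable (\<lambda>n. a n * r ^ n)"
    and lim: "((\<lambda>r. \<Sum>n. a n * r ^ n) \<longlongrightarrow> L) (at_left R)"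
  shows "summable (\<lambda>n. a n * R ^ n)"
proof (rule summableI_nonneg_bounded)
  show "0 \<le> a n * R ^ n" for n using a R by simp
  fix n
  have "((\<lambda>r. \<Sum>k<n. a k * r ^ k) \<longlongrightarrow> (\<Sum>k<n. a k * R ^ k)) (at_left R)"
    by (intro tendsto_intros)
  moreover have "\<forall>\<^sub>F r in at_left R. (\<Sum>k<n. a k * r ^ k) \<le> (\<Sum>n. a n * r ^ n)"
    using eventually_at_left_real[OF R]
  proof eventually_elim
    case (elim r)
    then show ?case using a by (intro sum_le_suminf summ) auto
  qed
  ultimately show "(\<Sum>k<n. a k * R ^ k) \<le> L"
    using lim by (intro tendsto_le[OF _ lim]) auto
qed

lemma summable_power_series_le:
  fixes a :: "nat \<Rightarrow> real" and z :: "'a :: {real_normed_field, banach}"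
  assumes a: "\<And>n. 0 \<le> a n" and summ: "summable (\<lambda>n. a n * R ^ n)" and z: "norm z \<le> R"
  shows "summable (\<lambda>n. of_real (a n) * z ^ n)"
  by (rule summable_comparison_test'[OF summ])
     (use a z in \<open>auto simp: norm_mult norm_power intro!: mult_left_mono power_mono\<close>)

lemma continuous_on_power_series_cball:
  fixes a :: "nat \<Rightarrow> real"
  assumes a: "\<And>n. 0 \<le> a n" and summ: "summable (\<lambda>n. a n * R ^ n)"
  shows "continuous_on (cball 0 R) (\<lambda>z :: 'a :: {real_normed_field, banach}. \<Sum>n. of_real (a n) * z ^ n)"
proof (rule uniform_limit_theorem)
  show "uniform_limit (cball 0 R) (\<lambda>n z :: 'a. \<Sum>i<n. of_real (a i) * z ^ i)
          (\<lambda>z. \<Sum>i. of_real (a i) * z ^ i) sequentially"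
    by (rule Weierstrass_m_test[OF _ summ])
       (use a in \<open>auto simp: norm_mult norm_power intro!: mult_left_mono power_mono\<close>)
qed (auto intro!: always_eventually continuous_intros)

lemma at_bd_eq:
  assumes R: "0 < R" and cont: "continuous_on {0..R} F"
    and eq: "\<And>r. 0 \<le> r \<Longrightarrow> r < R \<Longrightarrow> G r = F r" and r: "0 \<le> r" "r \<le> R"
  shows "at_bd R G r = F r"
proof (cases "r < R")
  case True
  then show ?thesis using eq r by (simp add: at_bd_def)
next
  case False
  then have [simp]: "r = R" using r by simp
  have "(F \<longlongrightarrow> F R) (at R within {0..R})"
    using cont R by (simp add: continuous_on_def)
  then have "(F \<longlongrightarrow> F R) (at_left R)"
    using R by (simp add: at_within_Icc_at_left)
  moreover have "\<forall>\<^sub>F r in at_left R. F r = G r"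
    using eventually_at_left_real[OF R] by eventually_elim (simp add: eq)
  ultimately have "(G \<longlongrightarrow> F R) (at_left R)"
    by (rule Lim_transform_eventually)
  then show ?thesis by (simp add: at_bd_def tendsto_Lim)
qed

lemma power_series_deriv_sums:
  fixes a :: "nat \<Rightarrow> real"
  assumes R: "ereal R \<le> conv_radius a" and r: "0 \<le> r" "r < R"
  defines "g \<equiv> \<lambda>r. \<Sum>n. a n * r ^ n"
  shows "(\<lambda>n. real n * a n * r ^ n) sums (r * deriv g r)"
    and "(\<lambda>n. real n * (real n - 1) * a n * r ^ n) sums (r ^ 2 * (deriv ^^ 2) g r)"
proof -
  let ?A = "Abs_fps a"
  have g: "g = eval_fps ?A" by (simp add: g_def eval_fps_def fun_eq_iff)
  have cr: "ereal R \<le> fps_conv_radius ?A" using R by (simp add: fps_conv_radius_def)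
  have cr1: "ereal R \<le> fps_conv_radius (fps_deriv ?A)"
    using cr fps_conv_radius_deriv order_trans by blast
  have cr2: "ereal R \<le> fps_conv_radius (fps_deriv (fps_deriv ?A))"
    using cr1 fps_conv_radius_deriv order_trans by blast
  have less: "ereal (norm x) < c" if "norm x < R" "ereal R \<le> c" for x :: real and c
    by (rule less_le_trans[OF _ that(2)]) (use that(1) in simp)
  have d1: "deriv g x = eval_fps (fps_deriv ?A) x" if "norm x < R" for x
    unfolding g using eval_fps_deriv[of x ?A] less[OF that cr] by simp
  have "\<forall>\<^sub>F x in nhds r. x \<in> ball 0 R"
    using r by (intro eventually_nhds_in_open) auto
  then have "\<forall>\<^sub>F x in nhds r. deriv g x = eval_fps (fps_deriv ?A) x"
    by eventually_elim (rule d1, simp)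
  then have "(deriv ^^ 2) g r = deriv (eval_fps (fps_deriv ?A)) r"
    by (simp add: numeral_2_eq_2 deriv_cong_ev)
  also have "\<dots> = eval_fps (fps_deriv (fps_deriv ?A)) r"
    using eval_fps_deriv[of r "fps_deriv ?A"] less[OF _ cr1, of r] r by simp
  finally have d2: "(deriv ^^ 2) g r = eval_fps (fps_deriv (fps_deriv ?A)) r" .
  have "(\<lambda>n. r * (fps_nth (fps_deriv ?A) n * r ^ n)) sums (r * deriv g r)"
    using d1[of r] r by (intro sums_mult) (use sums_eval_fps[of r "fps_deriv ?A"] less[OF _ cr1, of r] in auto)
  then have "(\<lambda>n. real (Suc n) * a (Suc n) * r ^ Suc n) sums (r * deriv g r)"
    by (simp add: algebra_simps)
  then show "(\<lambda>n. real n * a n * r ^ n) sums (r * deriv g r)"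
    by (subst (asm) sums_Suc_iff) simp
  have "(\<lambda>n. r ^ 2 * (fps_nth (fps_deriv (fps_deriv ?A)) n * r ^ n)) sums (r ^ 2 * (deriv ^^ 2) g r)"
    unfolding d2 by (intro sums_mult sums_eval_fps) (use less[OF _ cr2, of r] r in auto)
  moreover have "r ^ 2 * (fps_nth (fps_deriv (fps_deriv ?A)) n * r ^ n)
      = real (Suc (Suc n)) * (real (Suc (Suc n)) - 1) * a (Suc (Suc n)) * r ^ Suc (Suc n)" for n
    by (simp add: power2_eq_square algebra_simps)
  ultimately have "(\<lambda>n. real (Suc (Suc n)) * (real (Suc (Suc n)) - 1) * a (Suc (Suc n)) * r ^ Suc (Suc n))
      sums (r ^ 2 * (deriv ^^ 2) g r)" by (simp only:)
  then have "(\<lambda>n. real (Suc n) * (real (Suc n) - 1) * a (Suc n) * r ^ Suc n)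
      sums (r ^ 2 * (deriv ^^ 2) g r)"
    by (subst (asm) sums_Suc_iff) simp
  then show "(\<lambda>n. real n * (real n - 1) * a n * r ^ n) sums (r ^ 2 * (deriv ^^ 2) g r)"
    by (subst (asm) sums_Suc_iff) simp
qed

lemma zcoeff_has_integral:
  assumes r: "0 < r" and F: "F holomorphic_on ball 0 r" "continuous_on (cball 0 r) F"
  shows "((\<lambda>t. F (of_real r * cis t) * cis (- (real N * t))) has_integral
           of_real (2 * pi * r ^ N) * zcoeff F N) {-pi..pi}"
proof -
  define h where "h t = F (of_real r * cis t) * cis (- (real N * t))" for t
  have "((\<lambda>u. F u / u ^ Suc N) has_contour_integral (2 * pi * \<i>) / fact N * (deriv ^^ N) F 0)
          (circlepath 0 r)"
    using Cauchy_has_contour_integral_higher_derivative_circlepath[OF F(2,1), of 0 N] r by simp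
  then have "((\<lambda>t. F (0 + r * cis t) / (0 + r * cis t) ^ Suc N * r * \<i> * cis t) has_integral
      (2 * pi * \<i>) / fact N * (deriv ^^ N) F 0) {0..2 * pi}"
    unfolding circlepath_def by (subst (asm) has_contour_integral_part_circlepath_iff) auto
  then have "((\<lambda>t. of_real (r ^ N) / \<i> * (F (0 + r * cis t) / (0 + r * cis t) ^ Suc N * r * \<i> * cis t)) has_integral
      of_real (r ^ N) / \<i> * ((2 * pi * \<i>) / fact N * (deriv ^^ N) F 0)) {0..2 * pi}"
    by (rule has_integral_mult_right)
  moreover have "of_real (r ^ N) / \<i> * (F (0 + r * cis t) / (0 + r * cis t) ^ Suc N * r * \<i> * cis t) = h t" for t
  proof -
    have "cis (- (real N * t)) = 1 / cis t ^ N"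
      by (simp only: Complex.DeMoivre cis_inverse inverse_eq_divide[symmetric])
    then show ?thesis using r by (simp add: h_def power_mult_distrib field_simps)
  qed
  moreover have "of_real (r ^ N) / \<i> * ((2 * pi * \<i>) / fact N * (deriv ^^ N) F 0)
      = of_real (2 * pi * r ^ N) * zcoeff F N"
    by (simp add: zcoeff_def field_simps)
  ultimately have h: "(h has_integral of_real (2 * pi * r ^ N) * zcoeff F N) {0..2 * pi}"
    by simp
  then have "h integrable_on {0..2 * pi}" by blast
  then have "h integrable_on {0..pi}" "h integrable_on {pi..2 * pi}"
    by (auto elim!: integrable_subinterval_real)
  then obtain I J where I: "(h has_integral I) {0..pi}" and J: "(h has_integral J) {pi..2 * pi}"
    by blast
  have "((\<lambda>t. h (t + 2 * pi)) has_integral J) {-pi..0}"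
    using has_integral_shift_real_ivl[OF J, of "2 * pi"] by simp
  moreover have "h (t + 2 * pi) = h t" for t
  proof -
    have "cis (- (real N * (t + 2 * pi))) = cis (- (real N * t)) * cis (- (2 * pi * real N))"
      by (simp add: cis_mult algebra_simps)
    also have "cis (- (2 * pi * real N)) = 1"
      using cis_multiple_2pi[of "- real N"] by simp
    finally show ?thesis by (simp add: h_def cis_mult[symmetric])
  qed
  ultimately have "(h has_integral J) {-pi..0}" by simp
  then have "(h has_integral J + I) {-pi..pi}"
    using I by (intro has_integral_combine[of _ 0]) auto
  moreover have "(h has_integral I + J) {0..2 * pi}"
    using I J by (intro has_integral_combine[of _ pi]) auto
  then have "I + J = of_real (2 * pi * r ^ N) * zcoeff F N"
    using h has_integral_unique by blast
  ultimately have "(h has_integral of_real (2 * pi * r ^ N) * zcoeff F N) {-pi..pi}"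
    by (simp add: add.commute)
  then show ?thesis unfolding h_def[abs_def] .
qed

lemma zcoeff_exp_recursion:
  assumes G: "G has_fps_expansion Abs_fps (\<lambda>j. of_real (x j / real j))"
  shows "zcoeff (\<lambda>z. exp (G z)) 0 = 1"
    and "of_nat (Suc n) * zcoeff (\<lambda>z. exp (G z)) (Suc n)
       = (\<Sum>i\<le>n. of_real (x (Suc i)) * zcoeff (\<lambda>z. exp (G z)) (n - i))"
proof -
  define H where "H = Abs_fps (\<lambda>j. complex_of_real (x j / real j))"
  define P where "P = fps_exp 1 oo H"
  have H0: "fps_nth H 0 = 0" by (simp add: H_def)
  have "(exp \<circ> G) has_fps_expansion P"
    unfolding P_def using G H0 by (intro has_fps_expansion_compose has_fps_expansion_exp1) (auto simp: H_def)
  then have P: "fps_nth P m = zcoeff (\<lambda>z. exp (G z)) m" for m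
    using fps_nth_fps_expansion[of "exp \<circ> G" P m] by (simp add: zcoeff_def o_def)
  show "zcoeff (\<lambda>z. exp (G z)) 0 = 1"
    unfolding P[symmetric] by (simp add: P_def)
  have "fps_deriv P = fps_deriv H * P"
    unfolding P_def using fps_compose_deriv[OF H0, of "fps_exp 1"] by (simp add: mult.commute)
  then have "fps_nth (fps_deriv P) n = (\<Sum>i=0..n. fps_nth (fps_deriv H) i * fps_nth P (n - i))"
    by (simp add: fps_mult_nth)
  moreover have "fps_nth (fps_deriv H) i = of_real (x (Suc i))" for i
  proof -
    have "fps_nth (fps_deriv H) i = of_real (real (Suc i) * (x (Suc i) / real (Suc i)))"
      by (simp only: fps_deriv_nth H_def fps_nth_Abs_fps of_real_mult of_real_of_nat_eq Suc_eq_plus1)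
    also have "real (Suc i) * (x (Suc i) / real (Suc i)) = x (Suc i)"
      by simp
    finally show ?thesis .
  qed
  ultimately show "of_nat (Suc n) * zcoeff (\<lambda>z. exp (G z)) (Suc n)
       = (\<Sum>i\<le>n. of_real (x (Suc i)) * zcoeff (\<lambda>z. exp (G z)) (n - i))"
    by (simp add: P atLeast0AtMost)
qed

lemma gC_has_fps_expansion:
  assumes "0 < conv_radius (\<lambda>j. c j / real j)"
  shows "gC c has_fps_expansion Abs_fps (\<lambda>j. of_real (c j / real j))"
proof -
  have "conv_radius (\<lambda>j. complex_of_real (c j / real j)) = conv_radius (\<lambda>j. c j / real j)"
    using conv_radius_norm[of "\<lambda>j. complex_of_real (c j / real j)"]
      conv_radius_norm[of "\<lambda>j. c j / real j"] by (simp only: norm_of_real real_norm_def)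
  then have "0 < fps_conv_radius (Abs_fps (\<lambda>j. complex_of_real (c j / real j)))"
    using assms by (simp add: fps_conv_radius_def)
  from eval_fps_has_fps_expansion[OF this] show ?thesis
    by (simp add: eval_fps_def[abs_def] gC_def[abs_def])
qed

lemma gC_holomorphic:
  assumes "ereal R \<le> conv_radius (\<lambda>j. c j / real j)"
  shows "gC c holomorphic_on ball 0 R"
proof -
  have "conv_radius (\<lambda>j. complex_of_real (c j / real j)) = conv_radius (\<lambda>j. c j / real j)"
    using conv_radius_norm[of "\<lambda>j. complex_of_real (c j / real j)"]
      conv_radius_norm[of "\<lambda>j. c j / real j"] by (simp only: norm_of_real real_norm_def)
  then have "ereal R \<le> fps_conv_radius (Abs_fps (\<lambda>j. complex_of_real (c j / real j)))"
    using assms by (simp add: fps_conv_radius_def)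
  from ball_eball_mono[OF this] have "eval_fps (Abs_fps (\<lambda>j. complex_of_real (c j / real j))) holomorphic_on ball 0 R"
    by (intro holomorphic_on_eval_fps) auto
  then show ?thesis by (simp add: eval_fps_def[abs_def] gC_def[abs_def])
qed

section \<open>Laplace method on a circle\<close>

lemma one_minus_cos_diff_le: "1 - cos (x - y) \<le> 2 * (1 - cos x) + 2 * (1 - cos y :: real)"
proof -
  have *: "1 - cos w = 2 * (sin (w / 2))\<^sup>2" for w :: real
    using cos_double_sin[of "w / 2"] by simp
  define A B C D where "A = sin (x / 2)" "B = cos (y / 2)" "C = cos (x / 2)" "D = sin (y / 2)"
  have "sin ((x - y) / 2) = A * B - C * D"
    by (simp add: diff_divide_distrib sin_diff A_B_C_D_def)
  moreover have "(A * B - C * D)\<^sup>2 \<le> 2 * (A\<^sup>2 * B\<^sup>2) + 2 * (C\<^sup>2 * D\<^sup>2)"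
    using zero_le_power2[of "A * B + C * D"] by (simp add: power2_eq_square algebra_simps)
  moreover have "2 * (A\<^sup>2 * B\<^sup>2) + 2 * (C\<^sup>2 * D\<^sup>2) \<le> 2 * (A\<^sup>2 * 1) + 2 * (1 * D\<^sup>2)"
    unfolding A_B_C_D_def by (intro add_mono mult_left_mono mult_right_mono) (auto simp: cos_squared_eq)
  ultimately show ?thesis unfolding * A_B_C_D_def by simp
qed

lemma one_minus_cos_ge:
  fixes t :: real
  assumes "\<bar>t\<bar> \<le> pi"
  shows "t\<^sup>2 / 8 \<le> 1 - cos t"
proof -
  define u where "u = \<bar>t\<bar> / 2"
  have u: "0 \<le> u" "u \<le> 8/5" using assms pi_approx by (auto simp: u_def)
  have "\<bar>sin u - (\<Sum>m<3. sin_coeff m * u ^ m)\<bar> \<le> inverse (fact 3) * \<bar>u\<bar> ^ 3"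
    by (rule Maclaurin_sin_bound)
  then have "u - u ^ 3 / 6 \<le> sin u"
    using u by (simp add: eval_nat_numeral sin_coeff_def abs_if split: if_splits)
  moreover have "u * u\<^sup>2 \<le> u * 3"
    using u power_mono[of u "8/5" 2] by (intro mult_left_mono) (auto simp: power2_eq_square)
  ultimately have "u / 2 \<le> sin u" by (simp add: power3_eq_cube power2_eq_square)
  then have "(u / 2)\<^sup>2 \<le> (sin u)\<^sup>2" using u by (intro power_mono) auto
  moreover have "1 - cos t = 2 * (sin u)\<^sup>2"
    using cos_double_sin[of u] by (simp add: u_def)
  ultimately show ?thesis by (simp add: u_def power_divide)
qed

text \<open>The integers \<open>n\<close> for which \<open>1 - cos (n t)\<close> is dominated by the series form a subgroup of
  the integers. It contains the support of \<open>a\<close>, hence it contains 1.\<close>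
lemma cos_series_lower_bound:
  fixes a :: "nat \<Rightarrow> real"
  assumes a: "\<And>j. 0 \<le> a j" and summ: "summable a"
    and nonarith: "\<And>d. 1 < d \<Longrightarrow> \<exists>j\<ge>1. a j \<noteq> 0 \<and> \<not> d dvd j"
  shows "\<exists>c>0. \<forall>t. \<bar>t\<bar> \<le> pi \<longrightarrow> c * t\<^sup>2 \<le> (\<Sum>j. a j * (1 - cos (real j * t)))"
proof -
  define S where "S t = (\<Sum>j. a j * (1 - cos (real j * t)))" for t
  have sS: "summable (\<lambda>j. a j * (1 - cos (real j * t)))" for t
  proof (rule summable_comparison_test')
    show "summable (\<lambda>j. a j * 2)" using summ by (rule summable_mult2)
    show "norm (a j * (1 - cos (real j * t))) \<le> a j * 2" for j
      using a[of j] cos_ge_minus_one[of "real j * t"]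
      by (simp add: abs_mult mult_left_mono)
  qed
  have nn: "0 \<le> a j * (1 - cos (real j * t))" for j t using a[of j] by simp
  have S0: "0 \<le> S t" for t unfolding S_def using nn by (intro suminf_nonneg sS) auto
  define M where "M = {n::int. \<exists>C. 0 \<le> C \<and> (\<forall>t. 1 - cos (of_int n * t) \<le> C * S t)}"
  have supp: "int j \<in> M" if "a j \<noteq> 0" for j
  proof -
    have aj: "0 < a j" using that a[of j] by simp
    have "1 - cos (real j * t) \<le> (1 / a j) * S t" for t
    proof -
      have "(\<Sum>i\<in>{j}. a i * (1 - cos (real i * t))) \<le> S t"
        unfolding S_def using nn by (intro sum_le_suminf sS) auto
      then show ?thesis using aj by (simp add: field_simps)
    qed
    then show ?thesis unfolding M_def using aj by (auto intro!: exI[of _ "1 / a j"])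
  qed
  have diff: "m - n \<in> M" if m: "m \<in> M" and n: "n \<in> M" for m n
  proof -
    obtain C where C: "0 \<le> C" "\<And>t. 1 - cos (of_int m * t) \<le> C * S t" using m by (auto simp: M_def)
    obtain D where D: "0 \<le> D" "\<And>t. 1 - cos (of_int n * t) \<le> D * S t" using n by (auto simp: M_def)
    have "1 - cos (of_int (m - n) * t) \<le> (2 * C + 2 * D) * S t" for t
      using one_minus_cos_diff_le[of "of_int m * t" "of_int n * t"] C(2)[of t] D(2)[of t]
      by (simp add: algebra_simps)
    then show ?thesis using C(1) D(1) unfolding M_def by (auto intro!: exI[of _ "2 * C + 2 * D"])
  qed
  have mdiff: "m - int k * n \<in> M" if "m \<in> M" "n \<in> M" for m n k
  proof (induction k)
    case (Suc k)
    then show ?case using diff[OF Suc that(2)] by (simp add: algebra_simps)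
  qed (use that in simp)
  have "1 \<in> M"
  proof -
    define P where "P d \<longleftrightarrow> 0 < d \<and> int d \<in> M" for d
    define d where "d = (LEAST d. P d)"
    obtain j where "j \<ge> 1" "a j \<noteq> 0" using nonarith[of 2] by auto
    then have "P j" using supp by (simp add: P_def)
    then have "\<exists>d. P d" by blast
    then have d: "0 < d" "int d \<in> M" unfolding d_def using LeastI_ex[of P] by (auto simp: P_def)
    have "d dvd j" if "a j \<noteq> 0" for j
    proof (rule ccontr)
      assume "\<not> d dvd j"
      then have "0 < j mod d" by (simp add: dvd_eq_mod_eq_0)
      moreover have "int (j mod d) = int j - int (j div d) * int d"
        by (metis minus_div_mult_eq_mod of_nat_mult of_nat_mod zdiv_int)
      then have "int (j mod d) \<in> M" using mdiff[OF supp[OF that] d(2)] by simp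
      ultimately have "P (j mod d)" by (simp add: P_def)
      then have "d \<le> j mod d" unfolding d_def by (rule Least_le)
      then show False using mod_less_divisor[OF d(1), of j] by simp
    qed
    then have "d = 1" using nonarith[of d] d(1) by (cases "1 < d") auto
    then show ?thesis using d by simp
  qed
  then obtain C where C: "0 \<le> C" "\<And>t. 1 - cos t \<le> C * S t" by (auto simp: M_def)
  have "1 / (8 * (C + 1)) * t\<^sup>2 \<le> S t" if "\<bar>t\<bar> \<le> pi" for t
  proof -
    have "t\<^sup>2 / 8 \<le> C * S t" using one_minus_cos_ge[OF that] C(2)[of t] by simp
    also have "\<dots> \<le> (C + 1) * S t" using S0[of t] by (simp add: algebra_simps)
    finally show ?thesis using C(1) by (simp add: field_simps)
  qed
  then show ?thesis unfolding S_def using C(1) by (intro exI[of _ "1 / (8 * (C + 1))"]) auto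
qed

lemma cis_taylor_bounds:
  defines "h \<equiv> \<lambda>x::real. cis x - 1 - \<i> * x + x\<^sup>2 / 2"
  shows "norm (h x) \<le> x\<^sup>2" "norm (h x) \<le> \<bar>x\<bar> ^ 3 / 6"
proof -
  have "h x = iexp x - (\<Sum>k\<le>2. (\<i> * x) ^ k / fact k)"
    by (simp add: h_def cis_conv_exp numeral_2_eq_2 power2_eq_square fact_Suc algebra_simps)
  then show "norm (h x) \<le> x\<^sup>2" "norm (h x) \<le> \<bar>x\<bar> ^ 3 / 6"
    using iexp_approx2[of x 2] iexp_approx1[of x 2] by (simp_all add: fact_numeral eval_nat_numeral)
qed

lemma has_bochner_integral_gaussian:
  assumes q: "0 < q"
  shows "has_bochner_integral lborel (\<lambda>s. exp (- (q * s\<^sup>2 / 2))) (sqrt (2 * pi / q))"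
proof -
  have "has_bochner_integral lborel (\<lambda>s. sqrt (2 * pi / q) * normal_density 0 (1 / sqrt q) s) (sqrt (2 * pi / q) * 1)"
    using q by (intro has_bochner_integral_mult_right)
      (simp add: has_bochner_integral_iff integrable_normal_density integral_normal_density)
  then show ?thesis using q
    by (simp add: normal_density_def power_divide real_sqrt_divide real_sqrt_mult field_simps)
qed

lemma laplace_circle_limit:
  fixes a b :: "nat \<Rightarrow> real" and f :: "complex \<Rightarrow> complex" and r v :: "nat \<Rightarrow> real"
  assumes a: "\<And>j. 0 \<le> a j" and b: "\<And>j. 0 \<le> b j"
    and sa: "summable (\<lambda>j. (real j)\<^sup>2 * a j * R ^ j)" and sb: "summable (\<lambda>j. b j * R ^ j)"
    and f: "continuous_on (cball 0 R) f"
    and r: "\<And>N. r0 \<le> r N" "\<And>N. r N \<le> R" and r0: "0 < r0"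
    and v: "\<And>N. 1 \<le> v N" "\<And>N. v N \<le> v0"
    and saddle: "\<And>N. v N * (\<Sum>j. real j * a j * r N ^ j) = 1"
    and c: "0 < c" "\<And>t. \<bar>t\<bar> \<le> pi \<Longrightarrow> c * t\<^sup>2 \<le> (\<Sum>j. a j * r0 ^ j * (1 - cos (real j * t)))"
  defines "A \<equiv> \<lambda>z::complex. \<Sum>j. of_real (a j) * z ^ j"
    and "B \<equiv> \<lambda>z::complex. \<Sum>j. of_real (b j) * z ^ j"
    and "q \<equiv> \<lambda>N. v N * (\<Sum>j. (real j)\<^sup>2 * a j * r N ^ j)"
  shows "(\<lambda>N. of_real (sqrt (real N)) * integral {-pi..pi} (\<lambda>t.
            f (of_real (r N) * cis t)
            * exp (of_real (v N) * (B (of_real (r N) * cis t) - B (of_real (r N))))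
            * exp (of_nat N * (of_real (v N) * (A (of_real (r N) * cis t) - A (of_real (r N))) - \<i> * of_real t)))
          - f (of_real (r N)) * of_real (sqrt (2 * pi / q N))) \<longlonglongrightarrow> 0"
proof -
  have R: "0 < R" using r0 r[of 0] by linarith
  have rpos: "0 < r N" for N using r0 r(1)[of N] by linarith
  have v0: "0 \<le> v0" "0 \<le> v N" for N using v[of N] v[of 0] by linarith+
  have pw: "r N ^ j \<le> R ^ j" for N j using rpos[of N] r(2) by (intro power_mono) auto
  have s2: "summable (\<lambda>j. (real j)\<^sup>2 * a j * r N ^ j)" for N
    by (rule summable_comparison_test'[OF sa])
       (use a rpos pw in \<open>auto simp: abs_mult less_imp_le intro!: mult_left_mono\<close>)
  have jsq: "real j \<le> (real j)\<^sup>2" for j by (cases j) (auto simp: power2_eq_square)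
  have s1: "summable (\<lambda>j. real j * a j * r N ^ j)" for N
    by (rule summable_comparison_test'[OF s2[of N]])
       (use a rpos[of N] jsq in \<open>auto simp: abs_mult less_imp_le intro!: mult_right_mono\<close>)
  have saR: "summable (\<lambda>j. a j * R ^ j)"
  proof (rule summable_comparison_test'[OF sa])
    fix j :: nat assume "1 \<le> j"
    then have "1 * (a j * R ^ j) \<le> (real j)\<^sup>2 * (a j * R ^ j)"
      using a R by (intro mult_right_mono) auto
    then show "norm (a j * R ^ j) \<le> (real j)\<^sup>2 * a j * R ^ j"
      using a[of j] R by (simp add: abs_mult mult.assoc)
  qed
  define Z where "Z N t = of_real (r N) * cis t" for N t
  have Zin: "Z N t \<in> cball 0 R" for N t using r(2)[of N] rpos[of N] by (simp add: Z_def norm_mult)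
  have rin: "complex_of_real (r N) \<in> cball 0 R" for N using r(2)[of N] rpos[of N] by simp
  have sA: "summable (\<lambda>j. of_real (a j) * z ^ j)" if "z \<in> cball 0 R" for z :: complex
    using that by (intro summable_power_series_le[OF a saR]) auto
  have sB: "summable (\<lambda>j. of_real (b j) * z ^ j)" if "z \<in> cball 0 R" for z :: complex
    using that by (intro summable_power_series_le[OF b sb]) auto
  have contA: "continuous_on (cball 0 R) A" and contB: "continuous_on (cball 0 R) B"
    unfolding A_def B_def by (intro continuous_on_power_series_cball a b saR sb)+
  define \<psi> where "\<psi> N t = of_real (v N) * (A (Z N t) - A (of_real (r N))) - \<i> * of_real t" for N t
  define E where "E N t = exp (of_real (v N) * (B (Z N t) - B (of_real (r N))))" for N t
  define \<Phi> where "\<Phi> N t = f (Z N t) * E N t * exp (of_nat N * \<psi> N t)" for N t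

  have Adiff: "A (Z N t) - A (of_real (r N)) = (\<Sum>j. of_real (a j * r N ^ j) * (cis (real j * t) - 1))"
    and sAdiff: "summable (\<lambda>j. of_real (a j * r N ^ j) * (cis (real j * t) - 1))" for N t
  proof -
    have *: "of_real (a j) * Z N t ^ j - of_real (a j) * of_real (r N) ^ j
        = of_real (a j * r N ^ j) * (cis (real j * t) - 1)" for j
      by (simp add: Z_def power_mult_distrib Complex.DeMoivre algebra_simps)
    show "A (Z N t) - A (of_real (r N)) = (\<Sum>j. of_real (a j * r N ^ j) * (cis (real j * t) - 1))"
      unfolding A_def using suminf_diff[OF sA[OF Zin] sA[OF rin]] by (simp add: *)
    show "summable (\<lambda>j. of_real (a j * r N ^ j) * (cis (real j * t) - 1))"
      using summable_diff[OF sA[OF Zin[of N t]] sA[OF rin[of N]]] unfolding * .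
  qed

  have Re_psi: "Re (\<psi> N t) \<le> - c * t\<^sup>2" if t: "\<bar>t\<bar> \<le> pi" for N t
  proof -
    have "Re (A (Z N t) - A (of_real (r N))) = (\<Sum>j. a j * r N ^ j * (cos (real j * t) - 1))"
      unfolding Adiff using sAdiff[THEN Re_suminf] by simp
    moreover have sc: "summable (\<lambda>j. a j * r N ^ j * (cos (real j * t) - 1))"
      using sAdiff[THEN summable_Re] by simp
    moreover have "(\<Sum>j. a j * r N ^ j * (cos (real j * t) - 1)) = - (\<Sum>j. a j * r N ^ j * (1 - cos (real j * t)))"
      using summable_minus[OF sc]
      by (subst suminf_minus[symmetric]) (auto simp: algebra_simps)
    moreover have "c * t\<^sup>2 \<le> (\<Sum>j. a j * r N ^ j * (1 - cos (real j * t)))"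
    proof (rule order_trans[OF c(2)[OF t]], rule suminf_le)
      show sN: "summable (\<lambda>j. a j * r N ^ j * (1 - cos (real j * t)))"
        using summable_minus[OF sc] by (simp add: algebra_simps)
      show le: "a j * r0 ^ j * (1 - cos (real j * t)) \<le> a j * r N ^ j * (1 - cos (real j * t))" for j
        using a r r0 by (intro mult_right_mono mult_left_mono power_mono) auto
      show "summable (\<lambda>j. a j * r0 ^ j * (1 - cos (real j * t)))"
        by (rule summable_comparison_test'[OF sN]) (use le a r0 in \<open>auto simp: abs_mult\<close>)
    qed
    ultimately have "Re (A (Z N t) - A (of_real (r N))) \<le> - (c * t\<^sup>2)" by simp
    then have "v N * Re (A (Z N t) - A (of_real (r N))) \<le> v N * (- (c * t\<^sup>2))"
      using v0 by (intro mult_left_mono) auto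
    also have "\<dots> \<le> 1 * (- (c * t\<^sup>2))"
      using v(1)[of N] c(1) by (intro mult_right_mono_neg) auto
    finally show ?thesis by (simp add: \<psi>_def)
  qed

  have normE: "norm (E N t) \<le> 1" for N t
  proof -
    have "Re (B (Z N t)) \<le> norm (B (Z N t))" by (rule complex_Re_le_cmod)
    also have "\<dots> \<le> (\<Sum>j. norm (of_real (b j) * Z N t ^ j))"
      unfolding B_def
      using summable_power_series_le[OF b sb, of "r N"] r rpos[of N] b
      by (intro summable_norm) (simp add: Z_def norm_mult norm_power)
    also have "\<dots> = (\<Sum>j. b j * r N ^ j)"
      using b rpos[of N] by (simp add: Z_def norm_mult norm_power)
    also have "\<dots> = Re (B (of_real (r N)))"
      unfolding B_def using Re_suminf[OF sB[OF rin]] by (simp flip: of_real_power of_real_mult)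
    finally have "Re (B (Z N t) - B (of_real (r N))) \<le> 0" by simp
    then show ?thesis using v0(2)[of N] by (simp add: E_def mult_nonneg_nonpos)
  qed

  define h where "h x = cis x - 1 - \<i> * of_real x + (of_real x)\<^sup>2 / 2" for x :: real
  have h: "norm (h x) \<le> x\<^sup>2" "norm (h x) \<le> \<bar>x\<bar> ^ 3 / 6" for x
    unfolding h_def using cis_taylor_bounds[of x] by auto

  have psi_h: "\<psi> N t + of_real (q N * t\<^sup>2 / 2) = of_real (v N) * (\<Sum>j. of_real (a j * r N ^ j) * h (real j * t))"
    and sh: "summable (\<lambda>j. norm (of_real (a j * r N ^ j) * h (real j * t)))" for N t
  proof -
    show sh: "summable (\<lambda>j. norm (of_real (a j * r N ^ j) * h (real j * t)))"
    proof (rule summable_comparison_test')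
      show "summable (\<lambda>j. (real j)\<^sup>2 * a j * r N ^ j * t\<^sup>2)" using s2 by (rule summable_mult2)
      show "norm (norm (of_real (a j * r N ^ j) * h (real j * t))) \<le> (real j)\<^sup>2 * a j * r N ^ j * t\<^sup>2" for j
        using mult_left_mono[OF h(1)[of "real j * t"], of "a j * r N ^ j"] a rpos[of N]
        by (simp add: norm_mult norm_power abs_mult power_mult_distrib algebra_simps)
    qed
    have "(\<lambda>j. of_real (a j * r N ^ j) * (cis (real j * t) - 1) - \<i> * t * of_real (real j * a j * r N ^ j)
          + t\<^sup>2 / 2 * of_real ((real j)\<^sup>2 * a j * r N ^ j))
        sums (A (Z N t) - A (of_real (r N)) - \<i> * t * of_real (\<Sum>j. real j * a j * r N ^ j)
          + t\<^sup>2 / 2 * of_real (\<Sum>j. (real j)\<^sup>2 * a j * r N ^ j))"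
      unfolding Adiff
      by (intro sums_add sums_diff sums_mult summable_sums sAdiff sums_of_real s1 s2)
    moreover have "of_real (a j * r N ^ j) * (cis (real j * t) - 1) - \<i> * t * of_real (real j * a j * r N ^ j)
          + t\<^sup>2 / 2 * of_real ((real j)\<^sup>2 * a j * r N ^ j) = of_real (a j * r N ^ j) * h (real j * t)" for j
      by (simp add: h_def algebra_simps power_mult_distrib)
    ultimately have eq: "(\<Sum>j. of_real (a j * r N ^ j) * h (real j * t))
        = A (Z N t) - A (of_real (r N)) - \<i> * t * of_real (\<Sum>j. real j * a j * r N ^ j)
          + t\<^sup>2 / 2 * of_real (\<Sum>j. (real j)\<^sup>2 * a j * r N ^ j)"
      by (simp add: sums_iff)
    have "of_real (v N) * (\<Sum>j. of_real (a j * r N ^ j) * h (real j * t))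
        = of_real (v N) * (A (Z N t) - A (of_real (r N)))
          - \<i> * t * of_real (v N * (\<Sum>j. real j * a j * r N ^ j)) + of_real (q N * t\<^sup>2 / 2)"
      unfolding eq by (simp add: q_def algebra_simps)
    then show "\<psi> N t + of_real (q N * t\<^sup>2 / 2) = of_real (v N) * (\<Sum>j. of_real (a j * r N ^ j) * h (real j * t))"
      unfolding saddle by (simp add: \<psi>_def)
  qed

  have q1: "1 \<le> q N" for N
  proof -
    have "v N * (\<Sum>j. real j * a j * r N ^ j) \<le> q N"
      unfolding q_def using a rpos[of N] jsq v0
      by (intro mult_left_mono suminf_le s1 s2 mult_right_mono) (auto simp: less_imp_le)
    then show ?thesis by (simp add: saddle)
  qed

  have phase_limit: "(\<lambda>N. of_nat N * \<psi> N (s / sqrt (real N)) + of_real (q N * s\<^sup>2 / 2)) \<longlonglongrightarrow> 0" for s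
  proof (rule Lim_null_comparison)
    define G where "G j N = a j * R ^ j * (real N * norm (h (real j * (s / sqrt (real N)))))" for j N
    have G1: "norm (G j N) \<le> (real j)\<^sup>2 * a j * R ^ j * s\<^sup>2" for j N
    proof -
      have "real N * norm (h (real j * (s / sqrt (real N)))) \<le> real N * (real j * (s / sqrt (real N)))\<^sup>2"
        by (intro mult_left_mono h) auto
      also have "\<dots> \<le> (real j)\<^sup>2 * s\<^sup>2" by (simp add: power_mult_distrib power_divide)
      finally have "real N * norm (h (real j * (s / sqrt (real N)))) \<le> (real j)\<^sup>2 * s\<^sup>2" .
      from mult_left_mono[OF this, of "a j * R ^ j"] show ?thesis
        using a[of j] R by (simp add: G_def abs_mult algebra_simps)
    qed
    have sM: "summable (\<lambda>j. (real j)\<^sup>2 * a j * R ^ j * s\<^sup>2)" using sa by (rule summable_mult2)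
    have sG: "summable (\<lambda>j. G j N)" for N
      by (rule summable_comparison_test'[OF sM]) (rule G1)
    have Glim: "(\<lambda>N. G j N) \<longlonglongrightarrow> 0" for j
    proof (rule Lim_null_comparison)
      show "\<forall>\<^sub>F N in sequentially. norm (G j N) \<le> a j * R ^ j * (\<bar>real j * s\<bar> ^ 3 / 6) / sqrt (real N)"
        using eventually_gt_at_top[of 0]
      proof eventually_elim
        case (elim N)
        have "real N * norm (h (real j * (s / sqrt (real N)))) \<le> real N * (\<bar>real j * (s / sqrt (real N))\<bar> ^ 3 / 6)"
          by (intro mult_left_mono h) auto
        also have "\<dots> = \<bar>real j * s\<bar> ^ 3 / 6 * (real N / sqrt (real N) ^ 3)"
          by (simp add: abs_mult power_mult_distrib power_divide mult_ac)
        also have "real N / sqrt (real N) ^ 3 = 1 / sqrt (real N)"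
          using elim by (simp add: power3_eq_cube field_simps)
        finally have "real N * norm (h (real j * (s / sqrt (real N)))) \<le> \<bar>real j * s\<bar> ^ 3 / 6 * (1 / sqrt (real N))" .
        from mult_left_mono[OF this, of "a j * R ^ j"] show ?case
          using a[of j] R by (simp add: G_def abs_mult algebra_simps)
      qed
      show "(\<lambda>N. a j * R ^ j * (\<bar>real j * s\<bar> ^ 3 / 6) / sqrt (real N)) \<longlonglongrightarrow> 0"
        by real_asymp
    qed
    have "\<forall>\<^sub>F (j, N) in at_top \<times>\<^sub>F sequentially. norm (G j N) \<le> (real j)\<^sup>2 * a j * R ^ j * s\<^sup>2"
      using G1 by (intro always_eventually) (simp only: case_prod_beta, blast)
    from tannerys_theorem[OF Glim this sM]
    have "(\<lambda>N. \<Sum>j. G j N) \<longlonglongrightarrow> (\<Sum>j. 0)" by simp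
    then have "(\<lambda>N. \<Sum>j. G j N) \<longlonglongrightarrow> 0" by simp
    then show "(\<lambda>N. v0 * (\<Sum>j. G j N)) \<longlonglongrightarrow> 0" by (rule tendsto_mult_right_zero)
    show "\<forall>\<^sub>F N in sequentially. norm (of_nat N * \<psi> N (s / sqrt (real N)) + of_real (q N * s\<^sup>2 / 2)) \<le> v0 * (\<Sum>j. G j N)"
      using eventually_gt_at_top[of 0]
    proof eventually_elim
      case (elim N)
      let ?t = "s / sqrt (real N)"
      have "of_nat N * \<psi> N ?t + of_real (q N * s\<^sup>2 / 2) = of_nat N * (\<psi> N ?t + of_real (q N * ?t\<^sup>2 / 2))"
        using elim by (simp add: power_divide algebra_simps flip: of_real_power)
      also have "norm \<dots> = v N * (real N * norm (\<Sum>j. of_real (a j * r N ^ j) * h (real j * ?t)))"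
        unfolding psi_h using v0(2)[of N] by (simp add: norm_mult)
      also have "\<dots> \<le> v N * (real N * (\<Sum>j. norm (of_real (a j * r N ^ j) * h (real j * ?t))))"
        using v0(2) by (intro mult_left_mono summable_norm sh) auto
      also have "real N * (\<Sum>j. norm (of_real (a j * r N ^ j) * h (real j * ?t)))
          = (\<Sum>j. real N * norm (of_real (a j * r N ^ j) * h (real j * ?t)))"
        by (rule suminf_mult[OF sh, symmetric])
      also have "\<dots> \<le> (\<Sum>j. G j N)"
      proof (intro suminf_le sG summable_mult sh)
        fix j
        have "a j * r N ^ j * (real N * norm (h (real j * ?t))) \<le> G j N"
          unfolding G_def using a pw by (intro mult_right_mono mult_left_mono) auto
        then show "real N * norm (of_real (a j * r N ^ j) * h (real j * ?t)) \<le> G j N"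
          using a[of j] rpos[of N] by (simp add: norm_mult norm_power algebra_simps)
      qed
      also have "v N * (\<Sum>j. G j N) \<le> v0 * (\<Sum>j. G j N)"
        using v(2) a R by (intro mult_right_mono suminf_nonneg sG) (auto simp: G_def)
      finally show ?case using v0(2)[of N] by (simp add: mult_left_mono)
    qed
  qed

  have "compact (f ` cball 0 R)" using f by (intro compact_continuous_image) auto
  then obtain M where M: "0 < M" "\<And>z. z \<in> cball 0 R \<Longrightarrow> norm (f z) \<le> M"
    using compact_imp_bounded bounded_pos by (metis imageI)

  have Zlim: "(\<lambda>N. dist (Z N (s / sqrt (real N))) (of_real (r N))) \<longlonglongrightarrow> 0" for s
  proof (rule Lim_null_comparison)
    show "\<forall>\<^sub>F N in sequentially. norm (dist (Z N (s / sqrt (real N))) (of_real (r N))) \<le> R * norm (cis (s / sqrt (real N)) - 1)"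
    proof (intro always_eventually allI)
      fix N
      have "Z N (s / sqrt (real N)) - of_real (r N) = of_real (r N) * (cis (s / sqrt (real N)) - 1)"
        by (simp add: Z_def algebra_simps)
      then show "norm (dist (Z N (s / sqrt (real N))) (of_real (r N))) \<le> R * norm (cis (s / sqrt (real N)) - 1)"
        using r(2) rpos[of N] by (simp add: dist_norm norm_mult mult_right_mono)
    qed
    have "(\<lambda>N. s / sqrt (real N)) \<longlonglongrightarrow> 0" by real_asymp
    then have "(\<lambda>N. R * norm (cis (s / sqrt (real N)) - 1)) \<longlonglongrightarrow> R * norm (cis 0 - 1)"
      by (intro tendsto_intros)
    then show "(\<lambda>N. R * norm (cis (s / sqrt (real N)) - 1)) \<longlonglongrightarrow> 0" by simp
  qed
  have unif: "(\<lambda>N. g (Z N (s / sqrt (real N))) - g (of_real (r N))) \<longlonglongrightarrow> 0"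
    if g: "continuous_on (cball 0 R) g" for g :: "complex \<Rightarrow> complex" and s
  proof -
    have "uniformly_continuous_on (cball 0 R) g"
      using g by (intro compact_uniformly_continuous) auto
    then have "(\<lambda>N. dist (g (Z N (s / sqrt (real N)))) (g (of_real (r N)))) \<longlonglongrightarrow> 0"
      using Zlim[of s] Zin rin unfolding uniformly_continuous_on_sequentially
      by (auto dest!: spec[of _ "\<lambda>N. Z N (s / sqrt (real N))"] spec[of _ "\<lambda>N. complex_of_real (r N)"])
    then show ?thesis by (simp add: dist_norm tendsto_norm_zero_iff)
  qed

  define \<Gamma> where "\<Gamma> N s = f (of_real (r N)) * of_real (exp (- (q N * s\<^sup>2 / 2)))" for N s
  define D where "D N s = indicator {-pi..pi} (s / sqrt (real N)) *\<^sub>R \<Phi> N (s / sqrt (real N)) - \<Gamma> N s" for N s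

  have pointwise: "(\<lambda>N. D N s) \<longlonglongrightarrow> 0" for s
  proof (rule Lim_null_comparison)
    let ?t = "\<lambda>N. s / sqrt (real N)"
    let ?X = "\<lambda>N. f (Z N (?t N)) - f (of_real (r N))"
    let ?Y = "\<lambda>N. E N (?t N) - 1"
    let ?W = "\<lambda>N. exp (of_nat N * \<psi> N (?t N) + of_real (q N * s\<^sup>2 / 2)) - 1"
    have "(\<lambda>N. of_real (v N) * (B (Z N (?t N)) - B (of_real (r N)))) \<longlonglongrightarrow> 0"
    proof (rule Lim_null_comparison)
      show "\<forall>\<^sub>F N in sequentially. norm (of_real (v N) * (B (Z N (?t N)) - B (of_real (r N))))
          \<le> v0 * norm (B (Z N (?t N)) - B (of_real (r N)))"
        using v v0 by (intro always_eventually allI) (auto simp: norm_mult intro!: mult_right_mono)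
      show "(\<lambda>N. v0 * norm (B (Z N (?t N)) - B (of_real (r N)))) \<longlonglongrightarrow> 0"
        using unif[OF contB] by (intro tendsto_mult_right_zero tendsto_norm_zero)
    qed
    from tendsto_diff[OF tendsto_exp[OF this] tendsto_const[of 1]]
    have Y: "?Y \<longlonglongrightarrow> 0" by (simp add: E_def)
    from tendsto_diff[OF tendsto_exp[OF phase_limit[of s]] tendsto_const[of 1]]
    have W: "?W \<longlonglongrightarrow> 0" by simp
    show "(\<lambda>N. norm (?X N) + M * norm (?Y N) + M * norm (?W N)) \<longlonglongrightarrow> 0"
      using tendsto_add[OF tendsto_add[OF tendsto_norm_zero[OF unif[OF f, of s]]
          tendsto_mult_right_zero[OF tendsto_norm_zero[OF Y], of M]]
          tendsto_mult_right_zero[OF tendsto_norm_zero[OF W], of M]] by simp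
    have "?t \<longlonglongrightarrow> 0" by real_asymp
    then have "(\<lambda>N. \<bar>?t N\<bar>) \<longlonglongrightarrow> 0" by (rule tendsto_rabs_zero)
    then have "\<forall>\<^sub>F N in sequentially. \<bar>?t N\<bar> < pi" by (rule order_tendstoD) simp
    then show "\<forall>\<^sub>F N in sequentially. norm (D N s) \<le> norm (?X N) + M * norm (?Y N) + M * norm (?W N)"
    proof eventually_elim
      case (elim N)
      let ?e = "exp (of_nat N * \<psi> N (?t N))" and ?g = "complex_of_real (exp (- (q N * s\<^sup>2 / 2)))"
      have "0 \<le> c * (?t N)\<^sup>2" using c(1) by simp
      then have "Re (\<psi> N (?t N)) \<le> 0" using Re_psi[of "?t N" N] elim by linarith
      then have "Re (of_nat N * \<psi> N (?t N)) \<le> 0" by (simp add: mult_nonneg_nonpos)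
      then have ne: "norm ?e \<le> 1" by simp
      have ng: "norm ?g \<le> 1" using q1[of N] by simp
      have eW: "?e - ?g = ?g * ?W N"
        by (simp add: exp_add exp_minus algebra_simps flip: exp_of_real)
      have "?t N \<in> {-pi..pi}" using elim by (simp only: atLeastAtMost_iff) linarith
      then have "D N s = \<Phi> N (?t N) - \<Gamma> N s" by (simp only: D_def indicator_simps(1) scaleR_one)
      then have Deq: "D N s = ?X N * (E N (?t N) * ?e) + f (of_real (r N)) * (?Y N * ?e) + f (of_real (r N)) * (?g * ?W N)"
        unfolding eW[symmetric] by (simp add: \<Phi>_def \<Gamma>_def algebra_simps)
      have "norm (D N s) \<le> norm (?X N) * (1 * 1) + M * (norm (?Y N) * 1) + M * (1 * norm (?W N))"
        unfolding Deq by (intro norm_triangle_mono; unfold norm_mult; intro mult_mono M(2) rin normE ne ng) (use M(1) in auto)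
      then show ?case by simp
    qed
  qed

  have bound: "norm (D N s) \<le> M * exp (- (2 * c * s\<^sup>2 / 2)) + M * exp (- (1 * s\<^sup>2 / 2))" if N: "0 < N" for N s
  proof -
    let ?t = "s / sqrt (real N)"
    have "norm (indicator {-pi..pi} ?t *\<^sub>R \<Phi> N ?t) \<le> M * exp (- (c * s\<^sup>2))"
    proof (cases "\<bar>?t\<bar> \<le> pi")
      case True
      have "real N * Re (\<psi> N ?t) \<le> real N * (- c * ?t\<^sup>2)"
        by (intro mult_left_mono Re_psi True) auto
      also have "\<dots> = - (c * s\<^sup>2)" using N by (simp add: power_divide)
      finally have e: "norm (exp (of_nat N * \<psi> N ?t)) \<le> exp (- (c * s\<^sup>2))" by simp
      have "norm (\<Phi> N ?t) \<le> M * 1 * exp (- (c * s\<^sup>2))"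
        unfolding \<Phi>_def norm_mult by (intro mult_mono M(2) Zin normE e) (use M(1) in auto)
      moreover have "?t \<in> {-pi..pi}" using True by (simp only: atLeastAtMost_iff) linarith
      ultimately show ?thesis by (simp only: indicator_simps(1) scaleR_one mult_1_right)
    next
      case False
      then have "?t \<notin> {-pi..pi}" by auto
      then show ?thesis using M(1) by simp
    qed
    moreover have "norm (\<Gamma> N s) \<le> M * exp (- (s\<^sup>2 / 2))"
    proof -
      have "1 * s\<^sup>2 \<le> q N * s\<^sup>2" using q1 by (intro mult_right_mono) auto
      then have "exp (- (q N * s\<^sup>2 / 2)) \<le> exp (- (s\<^sup>2 / 2))" by simp
      then show ?thesis
        unfolding \<Gamma>_def norm_mult using M by (intro mult_mono M(2) rin) auto
    qed
    ultimately show ?thesis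
      unfolding D_def by (intro order_trans[OF norm_triangle_ineq4] add_mono) simp_all
  qed

  have contPhi: "continuous_on {-pi..pi} (\<Phi> N)" for N
  proof -
    have "continuous_on {-pi..pi} (Z N)"
      unfolding Z_def by (intro continuous_intros)
    then have g: "continuous_on {-pi..pi} (\<lambda>t. g (Z N t))" if "continuous_on (cball 0 R) g" for g :: "complex \<Rightarrow> complex"
      using that Zin by (intro continuous_on_compose2[OF that]) auto
    show ?thesis unfolding \<Phi>_def E_def \<psi>_def
      by (intro continuous_intros g f contA contB)
  qed
  have intPhi: "integrable lborel (\<lambda>t. indicator {-pi..pi} t *\<^sub>R \<Phi> N t)" for N
    using borel_integrable_atLeastAtMost'[OF contPhi] unfolding set_integrable_def .
  have int1: "integrable lborel (\<lambda>s. indicator {-pi..pi} (s / sqrt (real N)) *\<^sub>R \<Phi> N (s / sqrt (real N)))"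
    and eq1: "(LINT s|lborel. indicator {-pi..pi} (s / sqrt (real N)) *\<^sub>R \<Phi> N (s / sqrt (real N)))
        = of_real (sqrt (real N)) * integral {-pi..pi} (\<Phi> N)" if N: "0 < N" for N
  proof -
    have k: "1 / sqrt (real N) \<noteq> 0" using N by simp
    show "integrable lborel (\<lambda>s. indicator {-pi..pi} (s / sqrt (real N)) *\<^sub>R \<Phi> N (s / sqrt (real N)))"
      using lborel_integrable_real_affine[OF intPhi[of N] k, of 0] by simp
    have "integral {-pi..pi} (\<Phi> N) = (LINT t|lborel. indicator {-pi..pi} t *\<^sub>R \<Phi> N t)"
      using set_borel_integral_eq_integral(2)[OF borel_integrable_atLeastAtMost'[OF contPhi[of N]]]
      by (simp add: set_lebesgue_integral_def)
    also have "\<dots> = \<bar>1 / sqrt (real N)\<bar> *\<^sub>R (LINT s|lborel. indicator {-pi..pi} (s / sqrt (real N)) *\<^sub>R \<Phi> N (s / sqrt (real N)))"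
      using lborel_integral_real_affine[OF k, of "\<lambda>t. indicator {-pi..pi} t *\<^sub>R \<Phi> N t" 0] by simp
    finally show "(LINT s|lborel. indicator {-pi..pi} (s / sqrt (real N)) *\<^sub>R \<Phi> N (s / sqrt (real N)))
        = of_real (sqrt (real N)) * integral {-pi..pi} (\<Phi> N)"
      using N by (simp add: scaleR_conv_of_real)
  qed
  have gauss: "has_bochner_integral lborel (\<Gamma> N) (f (of_real (r N)) * of_real (sqrt (2 * pi / q N)))" for N
    unfolding \<Gamma>_def using has_bochner_integral_gaussian[of "q N"] q1[of N]
    by (intro has_bochner_integral_mult_right has_bochner_integral_of_real) auto
  have intD: "integrable lborel (D N)" if "0 < N" for N
    unfolding D_def using int1[OF that] gauss[of N] by (intro Bochner_Integration.integrable_diff) (auto simp: has_bochner_integral_iff)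
  have valD: "(LINT s|lborel. D N s) = of_real (sqrt (real N)) * integral {-pi..pi} (\<Phi> N)
      - f (of_real (r N)) * of_real (sqrt (2 * pi / q N))" if "0 < N" for N
    unfolding D_def using int1[OF that] gauss[of N] eq1[OF that]
    by (subst Bochner_Integration.integral_diff) (auto simp: has_bochner_integral_iff)
  have "(\<lambda>N. LINT s|lborel. D (Suc N) s) \<longlonglongrightarrow> (LINT s::real|lborel. (0::complex))"
  proof (rule integral_dominated_convergence)
    show "integrable lborel (\<lambda>s. M * exp (- (2 * c * s\<^sup>2 / 2)) + M * exp (- (1 * s\<^sup>2 / 2)))"
      using has_bochner_integral_gaussian[of "2 * c"] has_bochner_integral_gaussian[of 1] c(1)
      by (intro Bochner_Integration.integrable_add integrable_mult_right) (auto simp: has_bochner_integral_iff)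
    show "AE s in lborel. (\<lambda>N. D (Suc N) s) \<longlonglongrightarrow> 0"
      using pointwise by (intro AE_I2 LIMSEQ_Suc)
    show "AE s in lborel. norm (D (Suc N) s) \<le> M * exp (- (2 * c * s\<^sup>2 / 2)) + M * exp (- (1 * s\<^sup>2 / 2))" for N
      using bound[of "Suc N"] by (intro AE_I2) simp
    show "D (Suc N) \<in> borel_measurable lborel" for N
      using intD[of "Suc N"] by (simp add: borel_measurable_integrable)
  qed simp
  then have "(\<lambda>N. of_real (sqrt (real (Suc N))) * integral {-pi..pi} (\<Phi> (Suc N))
      - f (of_real (r (Suc N))) * of_real (sqrt (2 * pi / q (Suc N)))) \<longlonglongrightarrow> 0"
    by (simp add: valD del: of_nat_Suc)
  from LIMSEQ_imp_Suc[OF this] show ?thesis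
    by (simp only: \<Phi>_def E_def \<psi>_def Z_def)
qed

section \<open>The critical case\<close>

locale critical_weights =
  fixes \<theta> \<kappa> :: "nat \<Rightarrow> real" and R :: real
  assumes nonneg_theta: "\<forall>j\<ge>1. 0 \<le> \<theta> j"
    and nonneg_kappa: "\<forall>j\<ge>1. 0 \<le> \<kappa> j"
    and nonarith: "\<not> (\<exists>j0::nat. j0 > 1 \<and> (\<forall>j\<ge>1. \<kappa> j \<noteq> 0 \<longrightarrow> j0 dvd j))"
    and R_pos: "R > 0"
    and rad_theta: "conv_radius (\<lambda>j. \<theta> j / real j) = ereal R"
    and rad_kappa: "conv_radius (\<lambda>j. \<kappa> j / real j) = ereal R"
    and fin_theta: "\<exists>L. (gR \<theta> \<longlongrightarrow> L) (at_left R)"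
    and fin_kappa: "\<exists>L. (gR \<kappa> \<longlongrightarrow> L) (at_left R)"
    and g1_R: "(gdiff 1 \<kappa> \<longlongrightarrow> 1) (at_left R)"
    and g2_R: "\<exists>L. (gdiff 2 \<kappa> \<longlongrightarrow> L) (at_left R)"
begin

definition a :: "nat \<Rightarrow> real" where "a j = \<kappa> j / real j"
definition b :: "nat \<Rightarrow> real" where "b j = \<theta> j / real j"
definition G1 :: "real \<Rightarrow> real" where "G1 r = (\<Sum>j. real j * a j * r ^ j)"
definition G2 :: "real \<Rightarrow> real" where "G2 r = (\<Sum>j. real j * (real j - 1) * a j * r ^ j)"

lemma a_nonneg: "0 \<le> a j" and b_nonneg: "0 \<le> b j"
  using nonneg_kappa nonneg_theta by (cases "j = 0"; simp add: a_def b_def)+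

lemma coeff_nonneg: "0 \<le> real j * a j" "0 \<le> real j * (real j - 1) * a j"
  using a_nonneg[of j] by (cases j; simp)+

lemma conv_radius_a: "conv_radius a = ereal R" and conv_radius_b: "conv_radius b = ereal R"
  using rad_kappa rad_theta by (simp_all add: a_def[abs_def] b_def[abs_def])

lemma gR_eq: "gR \<kappa> r = (\<Sum>j. a j * r ^ j)" "gR \<theta> r = (\<Sum>j. b j * r ^ j)"
  by (simp_all add: gR_def a_def b_def)

lemma gC_eq: "gC \<kappa> z = (\<Sum>j. of_real (a j) * z ^ j)" "gC \<theta> z = (\<Sum>j. of_real (b j) * z ^ j)"
  by (simp_all add: gC_def a_def b_def)

lemma gdiff_sums:
  assumes "0 \<le> r" "r < R"
  shows "(\<lambda>j. real j * a j * r ^ j) sums gdiff 1 \<kappa> r"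
    and "(\<lambda>j. real j * (real j - 1) * a j * r ^ j) sums gdiff 2 \<kappa> r"
  using power_series_deriv_sums[of R a r] assms conv_radius_a
  by (simp_all add: gdiff_def gR_eq[abs_def])

lemma eventually_gdiff_eq:
  "\<forall>\<^sub>F r in at_left R. gdiff 1 \<kappa> r = G1 r" "\<forall>\<^sub>F r in at_left R. gdiff 2 \<kappa> r = G2 r"
  using eventually_at_left_real[OF R_pos] gdiff_sums
  by (auto elim!: eventually_mono simp: G1_def G2_def sums_iff)

lemma summable_boundary:
  "summable (\<lambda>j. a j * R ^ j)" "summable (\<lambda>j. b j * R ^ j)"
  "summable (\<lambda>j. real j * a j * R ^ j)" "summable (\<lambda>j. real j * (real j - 1) * a j * R ^ j)"
proof -
  obtain K where "(gR \<kappa> \<longlongrightarrow> K) (at_left R)" using fin_kappa by blast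
  then show "summable (\<lambda>j. a j * R ^ j)"
    unfolding gR_eq[abs_def]
    by (rule summable_power_series_boundary[OF a_nonneg R_pos, rotated])
       (auto intro!: summable_in_conv_radius simp: conv_radius_a)
  obtain T where "(gR \<theta> \<longlongrightarrow> T) (at_left R)" using fin_theta by blast
  then show "summable (\<lambda>j. b j * R ^ j)"
    unfolding gR_eq[abs_def]
    by (rule summable_power_series_boundary[OF b_nonneg R_pos, rotated])
       (auto intro!: summable_in_conv_radius simp: conv_radius_b)
  have "(G1 \<longlongrightarrow> 1) (at_left R)"
    using Lim_transform_eventually[OF g1_R eventually_gdiff_eq(1)] .
  then show "summable (\<lambda>j. real j * a j * R ^ j)"
    unfolding G1_def[abs_def]
    by (rule summable_power_series_boundary[OF coeff_nonneg(1) R_pos, rotated])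
       (use gdiff_sums in \<open>auto simp: sums_iff\<close>)
  obtain L where "(gdiff 2 \<kappa> \<longlongrightarrow> L) (at_left R)" using g2_R by blast
  then have "(G2 \<longlongrightarrow> L) (at_left R)"
    using Lim_transform_eventually[OF _ eventually_gdiff_eq(2)] by blast
  then show "summable (\<lambda>j. real j * (real j - 1) * a j * R ^ j)"
    unfolding G2_def[abs_def]
    by (rule summable_power_series_boundary[OF coeff_nonneg(2) R_pos, rotated])
       (use gdiff_sums in \<open>auto simp: sums_iff\<close>)
qed

lemma summable_le:
  assumes "0 \<le> r" "r \<le> R"
  shows "summable (\<lambda>j. a j * r ^ j)" "summable (\<lambda>j. b j * r ^ j)"
    "summable (\<lambda>j. real j * a j * r ^ j)" "summable (\<lambda>j. real j * (real j - 1) * a j * r ^ j)"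
  using summable_power_series_le[OF a_nonneg summable_boundary(1), of r]
    summable_power_series_le[OF b_nonneg summable_boundary(2), of r]
    summable_power_series_le[OF coeff_nonneg(1) summable_boundary(3), of r]
    summable_power_series_le[OF coeff_nonneg(2) summable_boundary(4), of r] assms
  by simp_all

lemma sq_eq: "(real j)\<^sup>2 * a j * r ^ j = real j * a j * r ^ j + real j * (real j - 1) * a j * r ^ j"
  by (simp add: power2_eq_square algebra_simps)

lemma summable_sq:
  assumes "0 \<le> r" "r \<le> R"
  shows "summable (\<lambda>j. (real j)\<^sup>2 * a j * r ^ j)"
  unfolding sq_eq using summable_le(3,4)[OF assms] by (rule summable_add)

lemma continuous_on_G:
  "continuous_on {0..R} (gR \<kappa>)" "continuous_on {0..R} (gR \<theta>)"
  "continuous_on {0..R} G1" "continuous_on {0..R} G2"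
proof -
  have sub: "{0..R} \<subseteq> cball 0 R" by auto
  show "continuous_on {0..R} (gR \<kappa>)" "continuous_on {0..R} (gR \<theta>)"
    "continuous_on {0..R} G1" "continuous_on {0..R} G2"
    unfolding gR_eq[abs_def] G1_def[abs_def] G2_def[abs_def]
    using continuous_on_subset[OF continuous_on_power_series_cball[OF a_nonneg summable_boundary(1)] sub]
      continuous_on_subset[OF continuous_on_power_series_cball[OF b_nonneg summable_boundary(2)] sub]
      continuous_on_subset[OF continuous_on_power_series_cball[OF coeff_nonneg(1) summable_boundary(3)] sub]
      continuous_on_subset[OF continuous_on_power_series_cball[OF coeff_nonneg(2) summable_boundary(4)] sub]
    by simp_all
qed

lemma continuous_on_gC: "continuous_on (cball 0 R) (gC \<kappa>)" "continuous_on (cball 0 R) (gC \<theta>)"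
  unfolding gC_eq[abs_def]
  using continuous_on_power_series_cball[OF a_nonneg summable_boundary(1)]
    continuous_on_power_series_cball[OF b_nonneg summable_boundary(2)] by auto

lemma gC_of_real:
  assumes "0 \<le> r" "r \<le> R"
  shows "gC \<kappa> (of_real r) = of_real (gR \<kappa> r)" "gC \<theta> (of_real r) = of_real (gR \<theta> r)"
proof -
  note * = suminf_of_real[OF summable_le(1)[OF assms]] suminf_of_real[OF summable_le(2)[OF assms]]
  show "gC \<kappa> (of_real r) = of_real (gR \<kappa> r)" "gC \<theta> (of_real r) = of_real (gR \<theta> r)"
    unfolding gC_eq gR_eq * by simp_all
qed

lemma at_bd_values:
  assumes "0 \<le> r" "r \<le> R"
  shows "at_bd R (gR \<kappa>) r = gR \<kappa> r" "at_bd R (gR \<theta>) r = gR \<theta> r"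
    "at_bd R (gdiff 1 \<kappa>) r = G1 r" "at_bd R (gdiff 2 \<kappa>) r = G2 r"
proof -
  have "gdiff 1 \<kappa> x = G1 x" "gdiff 2 \<kappa> x = G2 x" if "0 \<le> x" "x < R" for x
    using gdiff_sums[OF that] by (simp_all add: G1_def G2_def sums_iff)
  then show "at_bd R (gR \<kappa>) r = gR \<kappa> r" "at_bd R (gR \<theta>) r = gR \<theta> r"
    "at_bd R (gdiff 1 \<kappa>) r = G1 r" "at_bd R (gdiff 2 \<kappa>) r = G2 r"
    using assms by (auto intro!: at_bd_eq[OF R_pos] continuous_on_G)
qed

lemma b2_eq:
  assumes "0 \<le> r" "r \<le> R"
  shows "b2 R \<kappa> r = (\<Sum>j. (real j)\<^sup>2 * a j * r ^ j)"
  unfolding b2_def at_bd_values[OF assms] G1_def G2_def sq_eq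
  by (rule suminf_add[OF summable_le(3,4)[OF assms]])

lemma G1_R: "G1 R = 1"
proof -
  have "(G1 \<longlongrightarrow> G1 R) (at R within {0..R})"
    using continuous_on_G(3) R_pos by (simp add: continuous_on_def)
  then have "(G1 \<longlongrightarrow> G1 R) (at_left R)"
    using R_pos by (simp add: at_within_Icc_at_left)
  moreover have "(G1 \<longlongrightarrow> 1) (at_left R)"
    using Lim_transform_eventually[OF g1_R eventually_gdiff_eq(1)] .
  ultimately show ?thesis by (intro tendsto_unique[of "at_left R"]) auto
qed

lemma exists_nonzero_a: "1 < d \<Longrightarrow> \<exists>j\<ge>1. a j \<noteq> 0 \<and> \<not> d dvd j"
  using nonarith unfolding a_def by (metis divide_eq_0_iff not_one_le_zero of_nat_eq_0_iff)

lemma G1_strict_mono: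
  assumes "0 \<le> x" "x < y" "y \<le> R"
  shows "G1 x < G1 y"
proof -
  obtain j where j: "j \<ge> 1" "a j \<noteq> 0" using exists_nonzero_a[of 2] by auto
  have s: "summable (\<lambda>j. real j * a j * y ^ j)" "summable (\<lambda>j. real j * a j * x ^ j)"
    using assms by (auto intro!: summable_le)
  have "0 < (\<Sum>j. real j * a j * y ^ j - real j * a j * x ^ j)"
  proof (rule suminf_pos2)
    show "summable (\<lambda>j. real j * a j * y ^ j - real j * a j * x ^ j)" using s by (rule summable_diff)
    show "0 \<le> real j * a j * y ^ j - real j * a j * x ^ j" for j
      using assms coeff_nonneg(1)[of j] by (auto intro!: mult_left_mono power_mono)
    have "0 < real j * a j" using j a_nonneg[of j] by simp
    moreover have "x ^ j < y ^ j" using j assms by (intro power_strict_mono) auto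
    ultimately have "real j * a j * x ^ j < real j * a j * y ^ j"
      by (rule mult_strict_left_mono[rotated])
    then show "0 < real j * a j * y ^ j - real j * a j * x ^ j" by simp
  qed
  also have "\<dots> = G1 y - G1 x" unfolding G1_def using s by (simp add: suminf_diff)
  finally show ?thesis by simp
qed

lemma rsol_props:
  assumes v: "1 \<le> v"
  shows "0 < rsol R \<kappa> v" "rsol R \<kappa> v \<le> R" "G1 (rsol R \<kappa> v) = 1 / v"
    and "\<And>r. 0 < r \<Longrightarrow> r \<le> R \<Longrightarrow> G1 r = 1 / v \<Longrightarrow> rsol R \<kappa> v = r"
proof -
  have "real j * a j * 0 ^ j = 0" for j by (cases j) auto
  then have G10: "G1 0 = 0" by (simp add: G1_def)
  have "\<exists>r\<ge>0. r \<le> R \<and> G1 r = 1 / v"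
    using v R_pos continuous_on_G(3) by (intro IVT') (auto simp: G10 G1_R)
  then obtain r where r: "0 \<le> r" "r \<le> R" "G1 r = 1 / v" by blast
  have "r \<noteq> 0" using r v G10 by auto
  then have r': "0 < r" using r by simp
  have uniq: "x = r" if "0 < x" "x \<le> R" "G1 x = 1 / v" for x
    using G1_strict_mono[of x r] G1_strict_mono[of r x] that r by (cases x r rule: linorder_cases) auto
  have eq: "0 < x \<and> x \<le> R \<and> at_bd R (gdiff 1 \<kappa>) x = 1 / v \<longleftrightarrow> x = r" for x
    using uniq[of x] r r' at_bd_values(3)[of x] by (metis less_imp_le)
  have rs: "rsol R \<kappa> v = r" unfolding rsol_def eq by simp
  show "0 < rsol R \<kappa> v" "rsol R \<kappa> v \<le> R" "G1 (rsol R \<kappa> v) = 1 / v"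
    and "\<And>r. 0 < r \<Longrightarrow> r \<le> R \<Longrightarrow> G1 r = 1 / v \<Longrightarrow> rsol R \<kappa> v = r"
    unfolding rs using r(2,3) r' by (auto dest: uniq)
qed

lemma rsol_1: "rsol R \<kappa> 1 = R"
  using rsol_props(4)[of 1 R] R_pos G1_R by simp

lemma rsol_antimono:
  assumes "1 \<le> v" "v \<le> w"
  shows "rsol R \<kappa> w \<le> rsol R \<kappa> v"
proof (rule ccontr)
  assume "\<not> ?thesis"
  then have "G1 (rsol R \<kappa> v) < G1 (rsol R \<kappa> w)"
    using rsol_props(1)[of v] rsol_props(2)[of w] assms by (intro G1_strict_mono) auto
  then have "1 / v < 1 / w" using rsol_props(3) assms by simp
  then show False using assms by (simp add: field_simps)
qed

definition gen :: "(complex \<Rightarrow> complex) \<Rightarrow> real \<Rightarrow> nat \<Rightarrow> complex \<Rightarrow> complex" where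
  "gen f v N z = f z * exp (of_real v * (gC \<theta> z + of_nat N * gC \<kappa> z))"

definition main_term :: "real \<Rightarrow> nat \<Rightarrow> real" where
  "main_term v N = exp (v * GNR R \<theta> \<kappa> N (rsol R \<kappa> v)) /
     (rsol R \<kappa> v ^ N * sqrt (2 * pi * real N * v * b2 R \<kappa> (rsol R \<kappa> v)))"

text \<open>The prefactor equals \<open>exp (v G_N(r)) / (2 pi r^N sqrt N)\<close>, so the bracket is the error term of
  the rescaled Cauchy integral over the circle of radius \<open>r\<close>.\<close>
lemma zcoeff_gen_diff:
  assumes f: "f holomorphic_on ball 0 R" "continuous_on (cball 0 R) f" and v: "1 \<le> v" and N: "0 < N"
  defines "r \<equiv> rsol R \<kappa> v"
  defines "q \<equiv> v * b2 R \<kappa> r"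
  assumes q: "0 < q"
  shows "zcoeff (gen f v N) N - f (of_real r) * of_real (main_term v N)
     = of_real (main_term v N * sqrt (q / (2 * pi))) *
       (of_real (sqrt (real N)) * integral {-pi..pi} (\<lambda>t.
            f (of_real r * cis t)
            * exp (of_real v * (gC \<theta> (of_real r * cis t) - gC \<theta> (of_real r)))
            * exp (of_nat N * (of_real v * (gC \<kappa> (of_real r * cis t) - gC \<kappa> (of_real r)) - \<i> * of_real t)))
        - f (of_real r) * of_real (sqrt (2 * pi / q)))"
    (is "_ = _ * (_ * integral _ ?\<Phi> - _)")
proof -
  have r: "0 < r" "r \<le> R" using rsol_props(1,2)[OF v] by (auto simp: r_def)
  have bsub: "ball 0 r \<subseteq> ball (0::complex) R" and csub: "cball 0 r \<subseteq> cball (0::complex) R"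
    using r by auto
  have holo: "gen f v N holomorphic_on ball 0 r"
    unfolding gen_def
    by (intro holomorphic_intros holomorphic_on_subset[OF _ bsub] f gC_holomorphic)
       (simp_all add: rad_theta rad_kappa)
  have cont: "continuous_on (cball 0 r) (gen f v N)"
    unfolding gen_def
    by (intro continuous_intros continuous_on_subset[OF _ csub] f continuous_on_gC)
  define e where "e = exp (v * GNR R \<theta> \<kappa> N r)"
  have e: "of_real e = exp (of_real v * (gC \<theta> (of_real r) + of_nat N * gC \<kappa> (of_real r)))"
    using at_bd_values[of r] gC_of_real[of r] r by (simp add: e_def GNR_def flip: exp_of_real)
  have "exp (of_real v * (x + of_nat N * y)) * cis (- (real N * t))
      = exp (of_real v * (x' + of_nat N * y'))
        * (exp (of_real v * (x - x')) * exp (of_nat N * (of_real v * (y - y') - \<i> * of_real t)))"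
    for x y x' y' :: complex and t
    unfolding cis_conv_exp exp_add[symmetric] by (rule arg_cong[of _ _ exp]) (simp add: algebra_simps)
  then have "gen f v N (of_real r * cis t) * cis (- (real N * t)) = of_real e * ?\<Phi> t" for t
    unfolding e gen_def by (simp only: mult.assoc mult.left_commute[of "exp _" "f _"])
  then have "((\<lambda>t. of_real e * ?\<Phi> t) has_integral of_real (2 * pi * r ^ N) * zcoeff (gen f v N) N) {-pi..pi}"
    using zcoeff_has_integral[OF r(1) holo cont, of N] by simp
  then have "integral {-pi..pi} (\<lambda>t. of_real e * ?\<Phi> t) = of_real (2 * pi * r ^ N) * zcoeff (gen f v N) N"
    by (rule integral_unique)
  then have z: "zcoeff (gen f v N) N = of_real (e / (2 * pi * r ^ N)) * integral {-pi..pi} ?\<Phi>"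
    using r by (simp add: field_simps)
  have m: "main_term v N = e / (r ^ N * (sqrt (2 * pi) * sqrt (real N) * sqrt q))"
    by (simp add: main_term_def e_def r_def q_def real_sqrt_mult mult_ac)
  have "main_term v N * sqrt (q / (2 * pi)) * sqrt (real N) = e / (r ^ N * (sqrt (2 * pi) * sqrt (2 * pi)))"
    unfolding m real_sqrt_divide using q N by (simp add: field_simps del: real_sqrt_mult_self)
  then have m1: "main_term v N * sqrt (q / (2 * pi)) * sqrt (real N) = e / (2 * pi * r ^ N)"
    by (simp add: mult_ac)
  have m2: "main_term v N * sqrt (q / (2 * pi)) * sqrt (2 * pi / q) = main_term v N"
    using q by (simp add: real_sqrt_divide)
  have alg: "of_real (A * n) * I - F * of_real (A * w) = of_real A * (of_real n * I - F * of_real w)"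
    for A n w and I F :: complex
    by (simp add: algebra_simps)
  show ?thesis
    unfolding z alg[of "main_term v N * sqrt (q / (2 * pi))" "sqrt (real N)" _ _ "sqrt (2 * pi / q)",
        unfolded m1 m2, symmetric] ..
qed

lemma zcoeff_gen_asymptotics:
  assumes f: "f holomorphic_on ball 0 R" "continuous_on (cball 0 R) f" and v0: "1 \<le> v0" and \<epsilon>: "0 < \<epsilon>"
  shows "\<forall>\<^sub>F N in sequentially. \<forall>v\<in>{1..v0}.
     norm (zcoeff (gen f v N) N - f (of_real (rsol R \<kappa> v)) * of_real (main_term v N)) \<le> \<epsilon> * main_term v N"
proof -
  define P where "P N v \<longleftrightarrow> norm (zcoeff (gen f v N) N - f (of_real (rsol R \<kappa> v)) * of_real (main_term v N))
      \<le> \<epsilon> * main_term v N" for N v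
  text \<open>Testing each \<open>N\<close> at one worst \<open>v N\<close> reduces uniformity to a sequential limit.\<close>
  have "\<forall>N. \<exists>w. 1 \<le> w \<and> w \<le> v0 \<and> (P N w \<longrightarrow> (\<forall>u\<in>{1..v0}. P N u))"
    using v0 by (metis atLeastAtMost_iff order_refl)
  then obtain v where v: "\<And>N. 1 \<le> v N" "\<And>N. v N \<le> v0"
    and v_worst: "\<And>N. P N (v N) \<Longrightarrow> \<forall>u\<in>{1..v0}. P N u"
    by metis
  define r where "r N = rsol R \<kappa> (v N)" for N
  define r0 where "r0 = rsol R \<kappa> v0"
  define q where "q N = v N * b2 R \<kappa> (r N)" for N
  have r0: "0 < r0" "r0 \<le> R" using rsol_props(1,2)[OF v0] by (auto simp: r0_def)
  have r: "r0 \<le> r N" "r N \<le> R" "0 < r N" for N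
    using rsol_antimono[OF v(1,2)[of N]] rsol_props(1,2)[OF v(1)[of N]] by (auto simp: r_def r0_def)
  have b2R: "0 \<le> b2 R \<kappa> (r N)" "b2 R \<kappa> (r N) \<le> b2 R \<kappa> R" for N
    using r[of N] R_pos a_nonneg
    by (auto simp: b2_eq intro!: suminf_nonneg suminf_le summable_sq mult_left_mono power_mono)
  have q_ge: "1 \<le> q N" for N
  proof -
    have "G1 (r N) \<le> b2 R \<kappa> (r N)"
      unfolding b2_def using at_bd_values[of "r N"] r[of N] coeff_nonneg(2)
      by (auto simp: G2_def intro!: suminf_nonneg summable_le)
    then have "v N * (1 / v N) \<le> q N"
      unfolding q_def using v(1)[of N] rsol_props(3)[OF v(1)[of N]]
      by (intro mult_left_mono) (auto simp: r_def)
    then show ?thesis using v(1)[of N] by simp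
  qed
  have q_le: "q N \<le> v0 * b2 R \<kappa> R" for N
    unfolding q_def using v[of N] b2R[of N] by (intro mult_mono) auto
  obtain c where c: "0 < c" "\<And>t. \<bar>t\<bar> \<le> pi \<Longrightarrow> c * t\<^sup>2 \<le> (\<Sum>j. a j * r0 ^ j * (1 - cos (real j * t)))"
    using cos_series_lower_bound[of "\<lambda>j. a j * r0 ^ j"] a_nonneg r0 summable_le(1)[of r0] exists_nonzero_a
    by auto
  define D where "D N = of_real (sqrt (real N)) * integral {-pi..pi} (\<lambda>t.
            f (of_real (r N) * cis t)
            * exp (of_real (v N) * (gC \<theta> (of_real (r N) * cis t) - gC \<theta> (of_real (r N))))
            * exp (of_nat N * (of_real (v N) * (gC \<kappa> (of_real (r N) * cis t) - gC \<kappa> (of_real (r N))) - \<i> * of_real t)))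
          - f (of_real (r N)) * of_real (sqrt (2 * pi / q N))" for N
  have "D \<longlonglongrightarrow> 0"
  proof -
    have q': "q N = v N * (\<Sum>j. (real j)\<^sup>2 * a j * r N ^ j)" for N
      using r[of N] by (simp add: q_def b2_eq)
    have saddle: "v N * (\<Sum>j. real j * a j * r N ^ j) = 1" for N
      using rsol_props(3)[OF v(1)[of N]] v(1)[of N] by (simp add: r_def G1_def)
    show ?thesis
      unfolding D_def[abs_def] gC_eq q'
      by (rule laplace_circle_limit[OF a_nonneg b_nonneg summable_sq summable_boundary(2) f(2) r(1,2) r0(1) v saddle c])
         (use R_pos in auto)
  qed
  define K where "K = sqrt (v0 * b2 R \<kappa> R / (2 * pi)) + 1"
  have K: "0 < K" unfolding K_def using v0 b2R[of 0] by (intro add_nonneg_pos) auto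
  have "\<forall>\<^sub>F N in sequentially. norm (D N) < \<epsilon> / K"
    using \<open>D \<longlonglongrightarrow> 0\<close> \<epsilon> K by (intro order_tendstoD(2)[OF tendsto_norm_zero]) auto
  then have "\<forall>\<^sub>F N in sequentially. \<forall>w\<in>{1..v0}. P N w"
    using eventually_gt_at_top[of 0]
  proof eventually_elim
    case (elim N)
    have M: "0 \<le> main_term (v N) N"
      using r(3)[of N] v(1)[of N] b2R(1)[of N] by (simp add: main_term_def r_def)
    have "zcoeff (gen f (v N) N) N - f (of_real (rsol R \<kappa> (v N))) * of_real (main_term (v N) N)
        = of_real (main_term (v N) N * sqrt (q N / (2 * pi))) * D N"
      unfolding D_def r_def q_def using zcoeff_gen_diff[OF f v(1)[of N] elim(2)] q_ge[of N]
      by (simp add: q_def r_def)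
    then have "norm (zcoeff (gen f (v N) N) N - f (of_real (rsol R \<kappa> (v N))) * of_real (main_term (v N) N))
        = main_term (v N) N * (sqrt (q N / (2 * pi)) * norm (D N))"
      using M q_ge[of N] by (simp add: norm_mult)
    also have "\<dots> \<le> main_term (v N) N * (K * (\<epsilon> / K))"
    proof -
      have "sqrt (q N / (2 * pi)) \<le> sqrt (v0 * b2 R \<kappa> R / (2 * pi))"
        using q_le[of N] by (intro real_sqrt_le_mono divide_right_mono) auto
      then have "sqrt (q N / (2 * pi)) \<le> K" unfolding K_def by linarith
      then show ?thesis using M K elim(1) q_ge[of N] by (intro mult_left_mono mult_mono) auto
    qed
    also have "\<dots> = \<epsilon> * main_term (v N) N" using K by simp
    finally have "P N (v N)" unfolding P_def .
    then show ?case by (rule v_worst)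
  qed
  then show ?thesis by (simp only: P_def)
qed

lemma HN_eq_zcoeff: "HN \<theta> \<kappa> N = Re (zcoeff (gen (\<lambda>_. 1) 1 N) N)"
proof -
  define x where "x j = \<theta> j + real N * \<kappa> j" for j
  define G where "G z = gC \<theta> z + of_nat N * gC \<kappa> z" for z
  have "(\<lambda>z. gC \<theta> z + of_nat N * gC \<kappa> z) has_fps_expansion
      (Abs_fps (\<lambda>j. of_real (\<theta> j / real j)) + fps_const (of_nat N) * Abs_fps (\<lambda>j. of_real (\<kappa> j / real j)))"
    by (intro has_fps_expansion_add has_fps_expansion_mult has_fps_expansion_const gC_has_fps_expansion)
       (simp_all add: rad_theta rad_kappa R_pos)
  moreover have "Abs_fps (\<lambda>j. of_real (\<theta> j / real j)) + fps_const (of_nat N) * Abs_fps (\<lambda>j. of_real (\<kappa> j / real j))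
      = Abs_fps (\<lambda>j. complex_of_real (x j / real j))"
    by (rule fps_ext) (simp add: x_def add_divide_distrib)
  ultimately have "G has_fps_expansion Abs_fps (\<lambda>j. of_real (x j / real j))"
    by (simp add: G_def[abs_def])
  note rec = zcoeff_exp_recursion[OF this]
  define c where "c n = Re (zcoeff (\<lambda>z. exp (G z)) n)" for n
  have "cycle_sum x {1..N} = fact N * c N"
  proof (rule cycle_sum_recursion)
    show "c 0 = 1" by (simp add: c_def rec)
    fix n
    have "real (Suc n) * c n' = Re (of_nat (Suc n) * zcoeff (\<lambda>z. exp (G z)) n')" for n'
      by (simp add: c_def)
    then show "real (Suc n) * c (Suc n) = (\<Sum>i\<le>n. x (Suc i) * c (n - i))"
      by (simp only: rec) (simp add: c_def)
  qed auto
  then have "HN \<theta> \<kappa> N = c N" by (simp add: HN_eq_cycle_sum x_def[abs_def])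
  then show ?thesis by (simp add: c_def gen_def[abs_def] G_def)
qed

lemma HN_asymptotics: "HN \<theta> \<kappa> \<sim>[sequentially] main_term 1"
proof (rule smallo_imp_asymp_equiv, rule landau_o.smallI)
  fix \<epsilon> :: real assume "0 < \<epsilon>"
  have "\<forall>\<^sub>F N in sequentially. \<forall>v\<in>{1..1}. norm (zcoeff (gen (\<lambda>_. 1) v N) N
      - 1 * of_real (main_term v N)) \<le> \<epsilon> * main_term v N"
    using \<open>0 < \<epsilon>\<close> by (intro zcoeff_gen_asymptotics) (auto intro!: continuous_intros)
  then show "\<forall>\<^sub>F N in sequentially. norm (HN \<theta> \<kappa> N - main_term 1 N) \<le> \<epsilon> * norm (main_term 1 N)"
  proof eventually_elim
    case (elim N)
    have "norm (HN \<theta> \<kappa> N - main_term 1 N) = \<bar>Re (zcoeff (gen (\<lambda>_. 1) 1 N) N - of_real (main_term 1 N))\<bar>"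
      by (simp add: HN_eq_zcoeff)
    also have "\<dots> \<le> norm (zcoeff (gen (\<lambda>_. 1) 1 N) N - of_real (main_term 1 N))"
      by (rule abs_Re_le_cmod)
    also have "\<dots> \<le> \<epsilon> * main_term 1 N" using elim by simp
    also have "\<dots> \<le> \<epsilon> * norm (main_term 1 N)" using \<open>0 < \<epsilon>\<close> by (intro mult_left_mono) auto
    finally show ?case .
  qed
qed

end

theorem theorem3p7:
  fixes \<theta> \<kappa> :: "nat \<Rightarrow> real" and R :: real and f :: "complex \<Rightarrow> complex"
  assumes nonneg_theta: "\<forall>j\<ge>1. 0 \<le> \<theta> j"
    and nonneg_kappa: "\<forall>j\<ge>1. 0 \<le> \<kappa> j"
    and nonarith: "\<not> (\<exists>j0::nat. j0 > 1 \<and> (\<forall>j\<ge>1. \<kappa> j \<noteq> 0 \<longrightarrow> j0 dvd j))"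
    and kappa_pos: "\<exists>j\<ge>2. \<kappa> j > 0"
    and R_pos: "R > 0"
    and rad_theta: "conv_radius (\<lambda>j. \<theta> j / real j) = ereal R"
    and rad_kappa: "conv_radius (\<lambda>j. \<kappa> j / real j) = ereal R"
    and fin_theta: "\<exists>L. (gR \<theta> \<longlongrightarrow> L) (at_left R)"
    and fin_kappa: "\<exists>L. (gR \<kappa> \<longlongrightarrow> L) (at_left R)"
    and g1_R: "(gdiff 1 \<kappa> \<longlongrightarrow> 1) (at_left R)"
    and g2_R: "\<exists>L. (gdiff 2 \<kappa> \<longlongrightarrow> L) (at_left R) \<and> 0 < L"
    and f_holo: "f holomorphic_on ball 0 R"
    and f_cont: "continuous_on (cball 0 R) f"
  shows "(\<forall>v0\<ge>1. \<forall>\<epsilon>>0. \<forall>\<^sub>F N in sequentially. \<forall>v\<in>{1..v0}.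
           norm (zcoeff (\<lambda>z. f z * exp (complex_of_real v * (gC \<theta> z + of_nat N * gC \<kappa> z))) N
                 - f (complex_of_real (rsol R \<kappa> v)) *
                   complex_of_real (exp (v * GNR R \<theta> \<kappa> N (rsol R \<kappa> v)) /
                     (rsol R \<kappa> v ^ N * sqrt (2 * pi * real N * v * b2 R \<kappa> (rsol R \<kappa> v)))))
           \<le> \<epsilon> * (exp (v * GNR R \<theta> \<kappa> N (rsol R \<kappa> v)) /
                     (rsol R \<kappa> v ^ N * sqrt (2 * pi * real N * v * b2 R \<kappa> (rsol R \<kappa> v)))))
       \<and> (HN \<theta> \<kappa> \<sim>[sequentially]
           (\<lambda>N. exp (GNR R \<theta> \<kappa> N R) / (R ^ N * sqrt (2 * pi * real N * b2 R \<kappa> R))))"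
proof -
  interpret critical_weights \<theta> \<kappa> R
    using assms by unfold_locales blast+
  show ?thesis
    using zcoeff_gen_asymptotics[OF f_holo f_cont] HN_asymptotics
    unfolding gen_def main_term_def rsol_1 by simp
qed

end
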